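(* Let $\lambda=(\lambda_1^n,\lambda_{n+1},\dots,\lambda_l)$ be a partition with $l(\lambda)=l$ whose first $n$ parts equal $\lambda_1$, and let $\mu$ be a partition with $\mu_1\le\lambda_l$ and $l(\mu)\le n$; set $\mathcal{A}=\lambda/\mu$. Let $\lambda^{-1}$ denote the partition $(\lambda_1-\lambda_l,\lambda_1-\lambda_{l-1},\dots,\lambda_1-\lambda_{n+1})$, whose diagram is (up to translation) the rotation by $180^\circ$ of the skew diagram $(\lambda_1^l)/\lambda$. Let $\beta=\mathcal{B}([\mu]\otimes[\lambda^{-1}])$. Then \[\mathcal{C}([\mathcal{A}])=\big((\lambda_1^l)/\beta\big)^\circ=(\lambda_1-\beta_l,\lambda_1-\beta_{l-1},\dots,\lambda_1-\beta_1).\]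
   Context: Partitions are identified with Young diagrams (matrix coordinates); $\alpha_i=0$ for $i>l(\alpha)$; $(\lambda_1^l)$ is the $l\times\lambda_1$ rectangle; $(\cdot)^\circ$ denotes rotation by $180^\circ$. The Littlewood–Richardson coefficient $c(\lambda;\mu,\nu)$ is the number of semistandard fillings of $\lambda/\mu$ with content $\nu$ whose reverse row word is a lattice word. The skew character is $[\lambda/\mu]=\sum_\nu c(\lambda;\mu,\nu)[\nu]$ and the outer product is $[\alpha]\otimes[\gamma]=\sum_\nu c(\nu;\alpha,\gamma)[\nu]$ (irreducible characters $[\nu]$ of symmetric groups). For a character $\chi$, $[\alpha]\in\chi$ means $[\alpha]$ has nonzero coefficient in $\chi$; the base partition is $\mathcal{B}(\chi)_i=\min(\alpha_i\mid[\alpha]\in\chi)$ and the cover partition is $\mathcal{C}(\chi)_i=\max(\alpha_i\mid[\alpha]\in\chi)$. *)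

theory Defs
  imports Main "HOL-Library.Poly_Mapping"
begin

text \<open>
  A partition is the sequence of its parts, indexed from 1 and extended by zeros.
  Position 0 carries no part; fixing its value to 0 makes equality of partitions
  the same as equality of functions.
\<close>

definition is_partition :: "(nat \<Rightarrow> nat) \<Rightarrow> bool" where
  "is_partition \<alpha> \<longleftrightarrow>
     \<alpha> 0 = 0 \<and> (\<forall>i\<ge>1. \<alpha> (Suc i) \<le> \<alpha> i) \<and> finite {i. \<alpha> i \<noteq> 0}"

definition plength :: "(nat \<Rightarrow> nat) \<Rightarrow> nat" where
  "plength \<alpha> = card {i. \<alpha> i \<noteq> 0}"

definition psize :: "(nat \<Rightarrow> nat) \<Rightarrow> nat" where
  "psize \<alpha> = (\<Sum>i | \<alpha> i \<noteq> 0. \<alpha> i)"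

definition partitions_of :: "nat \<Rightarrow> (nat \<Rightarrow> nat) set" where
  "partitions_of m = {\<alpha>. is_partition \<alpha> \<and> psize \<alpha> = m}"

definition diagram :: "(nat \<Rightarrow> nat) \<Rightarrow> (nat \<times> nat) set" where
  "diagram \<alpha> = {(i, j). 1 \<le> i \<and> 1 \<le> j \<and> j \<le> \<alpha> i}"

definition skew_diagram :: "(nat \<Rightarrow> nat) \<Rightarrow> (nat \<Rightarrow> nat) \<Rightarrow> (nat \<times> nat) set" where
  "skew_diagram \<alpha> \<beta> = diagram \<alpha> - diagram \<beta>"

text \<open>The partition with \<open>a\<close> parts equal to \<open>b\<close>.\<close>

definition rect :: "nat \<Rightarrow> nat \<Rightarrow> nat \<Rightarrow> nat" where
  "rect a b = (\<lambda>i. if 1 \<le> i \<and> i \<le> a then b else 0)"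

text \<open>
  Rotation by 180 degrees about the centre of the \<open>a \<times> b\<close> rectangle; meaningful only
  for \<open>D \<subseteq> diagram (rect a b)\<close>, where the subtractions do not truncate.
\<close>

definition rotate180 :: "nat \<Rightarrow> nat \<Rightarrow> (nat \<times> nat) set \<Rightarrow> (nat \<times> nat) set" where
  "rotate180 a b D = (\<lambda>(i, j). (a + 1 - i, b + 1 - j)) ` D"

text \<open>
  Fillings of a skew diagram are total functions that vanish off the diagram, so that
  each filling is counted once.
\<close>

definition semistandard :: "(nat \<Rightarrow> nat) \<Rightarrow> (nat \<Rightarrow> nat) \<Rightarrow> (nat \<times> nat \<Rightarrow> nat) \<Rightarrow> bool" where
  "semistandard \<alpha> \<beta> T \<longleftrightarrow>
     (\<forall>x. x \<notin> skew_diagram \<alpha> \<beta> \<longrightarrow> T x = 0) \<and>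
     (\<forall>x\<in>skew_diagram \<alpha> \<beta>. 1 \<le> T x) \<and>
     (\<forall>i j j'. (i, j) \<in> skew_diagram \<alpha> \<beta> \<and> (i, j') \<in> skew_diagram \<alpha> \<beta> \<and> j < j'
        \<longrightarrow> T (i, j) \<le> T (i, j')) \<and>
     (\<forall>i i' j. (i, j) \<in> skew_diagram \<alpha> \<beta> \<and> (i', j) \<in> skew_diagram \<alpha> \<beta> \<and> i < i'
        \<longrightarrow> T (i, j) < T (i', j))"

definition has_content ::
    "(nat \<Rightarrow> nat) \<Rightarrow> (nat \<Rightarrow> nat) \<Rightarrow> (nat \<times> nat \<Rightarrow> nat) \<Rightarrow> (nat \<Rightarrow> nat) \<Rightarrow> bool" where
  "has_content \<alpha> \<beta> T \<nu> \<longleftrightarrow>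
     (\<forall>k\<ge>1. card {x \<in> skew_diagram \<alpha> \<beta>. T x = k} = \<nu> k)"

text \<open>Rows from top to bottom, each row from right to left.\<close>

definition reverse_row_word ::
    "(nat \<Rightarrow> nat) \<Rightarrow> (nat \<Rightarrow> nat) \<Rightarrow> (nat \<times> nat \<Rightarrow> nat) \<Rightarrow> nat list" where
  "reverse_row_word \<alpha> \<beta> T =
     concat (map (\<lambda>i. rev (map (\<lambda>j. T (i, j)) [\<beta> i + 1..<\<alpha> i + 1])) [1..<plength \<alpha> + 1])"

definition lattice_word :: "nat list \<Rightarrow> bool" where
  "lattice_word w \<longleftrightarrow>
     (\<forall>m\<le>length w. \<forall>k\<ge>1. count_list (take m w) (Suc k) \<le> count_list (take m w) k)"

text \<open>The Littlewood--Richardson coefficient; it is 0 unless \<open>\<mu> \<subseteq> \<alpha>\<close>.\<close>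

definition lr_coeff :: "(nat \<Rightarrow> nat) \<Rightarrow> (nat \<Rightarrow> nat) \<Rightarrow> (nat \<Rightarrow> nat) \<Rightarrow> nat" where
  "lr_coeff \<alpha> \<mu> \<nu> =
     (if diagram \<mu> \<subseteq> diagram \<alpha>
      then card {T. semistandard \<alpha> \<mu> T \<and> has_content \<alpha> \<mu> T \<nu> \<and>
                    lattice_word (reverse_row_word \<alpha> \<mu> T)}
      else 0)"

text \<open>
  The irreducible characters of all symmetric groups are indexed by the partitions and are
  linearly independent. A character is therefore represented by its expansion in this
  basis: a finitely supported map sending \<open>\<nu>\<close> to the multiplicity of \<open>[\<nu>]\<close>. The character
  \<open>c \<cdot> [\<nu>]\<close> is \<open>Poly_Mapping.single \<nu> c\<close>, and \<open>[\<alpha>] \<in> \<chi>\<close> is \<open>\<alpha> \<in> keys \<chi>\<close>.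
\<close>

type_synonym sym_char = "(nat \<Rightarrow> nat) \<Rightarrow>\<^sub>0 nat"

text \<open>
  Both sums below are restricted to the partitions of the only size for which the
  coefficient can be nonzero, so that the index set is finite.
\<close>

definition skew_char :: "(nat \<Rightarrow> nat) \<Rightarrow> (nat \<Rightarrow> nat) \<Rightarrow> sym_char" where
  "skew_char \<alpha> \<mu> =
     (\<Sum>\<nu>\<in>partitions_of (psize \<alpha> - psize \<mu>). Poly_Mapping.single \<nu> (lr_coeff \<alpha> \<mu> \<nu>))"

text \<open>The outer product of the irreducible characters of \<open>\<alpha>\<close> and \<open>\<gamma>\<close>.\<close>

definition outer_prod :: "(nat \<Rightarrow> nat) \<Rightarrow> (nat \<Rightarrow> nat) \<Rightarrow> sym_char" where
  "outer_prod \<alpha> \<gamma> =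
     (\<Sum>\<nu>\<in>partitions_of (psize \<alpha> + psize \<gamma>). Poly_Mapping.single \<nu> (lr_coeff \<nu> \<alpha> \<gamma>))"

definition base_partition :: "sym_char \<Rightarrow> nat \<Rightarrow> nat" where
  "base_partition \<chi> = (\<lambda>i. Min ((\<lambda>\<alpha>. \<alpha> i) ` Poly_Mapping.keys \<chi>))"

definition cover_partition :: "sym_char \<Rightarrow> nat \<Rightarrow> nat" where
  "cover_partition \<chi> = (\<lambda>i. Max ((\<lambda>\<alpha>. \<alpha> i) ` Poly_Mapping.keys \<chi>))"

text \<open>
  For a partition \<open>\<alpha>\<close> with \<open>l\<close> parts, the first \<open>n\<close> of them equal, the partition
  \<open>(\<alpha>\<^sub>1 - \<alpha>\<^sub>l, \<dots>, \<alpha>\<^sub>1 - \<alpha>\<^bsub>n+1\<^esub>)\<close>.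
\<close>

definition inv_partition :: "nat \<Rightarrow> (nat \<Rightarrow> nat) \<Rightarrow> nat \<Rightarrow> nat" where
  "inv_partition n \<alpha> =
     (\<lambda>i. if 1 \<le> i \<and> i \<le> plength \<alpha> - n then \<alpha> 1 - \<alpha> (plength \<alpha> + 1 - i) else 0)"

lemma finite_partitions_of: "finite (partitions_of m)"
proof -
  have "partitions_of m \<subseteq> {f. \<forall>i. (i \<in> {..m} \<longrightarrow> f i \<in> {..m}) \<and> (i \<notin> {..m} \<longrightarrow> f i = 0)}"
  proof
    fix \<alpha> assume "\<alpha> \<in> partitions_of m"
    hence p: "\<alpha> 0 = 0" "\<And>i. 1 \<le> i \<Longrightarrow> \<alpha> (Suc i) \<le> \<alpha> i" "finite {i. \<alpha> i \<noteq> 0}"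
      and s: "(\<Sum>i | \<alpha> i \<noteq> 0. \<alpha> i) = m"
      by (auto simp: partitions_of_def is_partition_def psize_def)
    have le: "\<alpha> i \<le> m" for i
      using member_le_sum[of i "{i. \<alpha> i \<noteq> 0}" \<alpha>] p(3) s by (cases "\<alpha> i = 0") auto
    have dec: "\<alpha> j \<le> \<alpha> i" if "i \<le> j" "1 \<le> i" for i j
      using that by (induction rule: dec_induct) (auto intro: order_trans[OF p(2)])
    have "\<alpha> i = 0" if i: "i > m" for i
    proof (rule ccontr)
      assume nz: "\<alpha> i \<noteq> 0"
      have "\<alpha> j \<noteq> 0" if "j \<in> {1..i}" for j
        using dec[of j i] that nz by auto
      hence sub: "{1..i} \<subseteq> {i. \<alpha> i \<noteq> 0}" by auto
      have "i = card {1..i}" by simp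
      also have "\<dots> \<le> card {i. \<alpha> i \<noteq> 0}" by (rule card_mono[OF p(3) sub])
      also have "\<dots> = (\<Sum>i | \<alpha> i \<noteq> 0. 1)" by simp
      also have "\<dots> \<le> (\<Sum>i | \<alpha> i \<noteq> 0. \<alpha> i)" by (rule sum_mono) simp
      finally show False using s i by simp
    qed
    with le show "\<alpha> \<in> {f. \<forall>i. (i \<in> {..m} \<longrightarrow> f i \<in> {..m}) \<and> (i \<notin> {..m} \<longrightarrow> f i = 0)}"
      by simp
  qed
  moreover have "finite {f. \<forall>i. (i \<in> {..m} \<longrightarrow> f i \<in> {..m}) \<and> (i \<notin> {..m} \<longrightarrow> f i = (0::nat))}"
    by (rule finite_set_of_finite_funs) auto
  ultimately show ?thesis by (rule finite_subset)
qed

lemma lookup_skew_char: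
  "Poly_Mapping.lookup (skew_char \<alpha> \<mu>) \<nu> =
     (if \<nu> \<in> partitions_of (psize \<alpha> - psize \<mu>) then lr_coeff \<alpha> \<mu> \<nu> else 0)"
  by (simp add: skew_char_def lookup_sum lookup_single when_def finite_partitions_of)

lemma lookup_outer_prod:
  "Poly_Mapping.lookup (outer_prod \<alpha> \<gamma>) \<nu> =
     (if \<nu> \<in> partitions_of (psize \<alpha> + psize \<gamma>) then lr_coeff \<nu> \<alpha> \<gamma> else 0)"
  by (simp add: outer_prod_def lookup_sum lookup_single when_def finite_partitions_of)

end

theory Submission
  imports Defs
begin

text \<open>
  Both sides are computed in closed form, part by part: the base partition of
  \<open>[\<mu>] \<otimes> [\<kappa>]\<close> has parts \<open>max \<mu>\<^sub>i \<kappa>\<^sub>i\<close>, and the cover partition of \<open>[\<lambda>/\<mu>]\<close> has parts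
  \<open>min \<lambda>\<^sub>i (\<lambda>\<^sub>1 - \<mu>\<^bsub>l+1-i\<^esub>)\<close>. This avoids the symmetry of Littlewood--Richardson coefficients under
  complementation in a rectangle. The bounds follow from the lattice property in the form that
  there are at most as many \<open>k + 1\<close> in the first \<open>s + 1\<close> rows as \<open>k\<close> in the first \<open>s\<close> rows; that each
  bound is attained is shown by an explicit filling.
\<close>

section \<open>Partitions and their diagrams\<close>

text \<open>Base and cover are taken part by part, so each index may have its own constituent: the
  explicit fillings depend on the index, and no constituent attaining all parts at once is sought.
  The two closed forms match because subtraction from \<open>lam 1\<close> turns a maximum into a
  minimum. Both upper bounds behind the cover hold for arbitrary skew diagrams; the difficulty is to
  attain them, and the shape hypotheses serve that end. Since \<open>\<mu> 1 \<le> lam l\<close>,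
  the columns meeting \<mu> reach down to row l, while every column longer than those of \<mu>
  allow, that is, beyond \<open>lam l\<close>, starts in row 1. Since the first n rows are full and
  contain \<mu>, an entry missing from the far right of the rectangle exceeds n, so entries are
  changed only below the rows of \<mu>.\<close>

lemma le_card_down_closed_iff:
  fixes P :: "nat \<Rightarrow> bool"
  assumes "finite {j. 1 \<le> j \<and> P j}" and "\<And>i j. 1 \<le> i \<Longrightarrow> i \<le> j \<Longrightarrow> P j \<Longrightarrow> P i" and "1 \<le> j"
  shows "j \<le> card {j. 1 \<le> j \<and> P j} \<longleftrightarrow> P j"
proof
  assume "P j"
  hence "{1..j} \<subseteq> {j. 1 \<le> j \<and> P j}" using assms(2) by auto
  from card_mono[OF assms(1) this] show "j \<le> card {j. 1 \<le> j \<and> P j}" by simp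
next
  assume le: "j \<le> card {j. 1 \<le> j \<and> P j}"
  show "P j"
  proof (rule ccontr)
    assume "\<not> P j"
    hence "{j. 1 \<le> j \<and> P j} \<subseteq> {1..<j}"
      using assms(2)[OF assms(3)] by (auto simp: not_le[symmetric])
    from card_mono[OF _ this] have "card {j. 1 \<le> j \<and> P j} \<le> j - 1" by simp
    thus False using le assms(3) by linarith
  qed
qed

definition conjugate :: "(nat \<Rightarrow> nat) \<Rightarrow> nat \<Rightarrow> nat" where
  "conjugate f j = card {r. 1 \<le> r \<and> j \<le> f r}"

text \<open>Finiteness is asked only at the given \<open>j\<close>: besides partitions, the lemma
  serves a column-length function bounded below by a possibly positive constant, whose lower level
  sets may be infinite.\<close>

lemma le_conjugate_iff:
  assumes "\<And>r s. 1 \<le> r \<Longrightarrow> r \<le> s \<Longrightarrow> f s \<le> f r" and "finite {r. 1 \<le> r \<and> j \<le> f r}" and "1 \<le> r"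
  shows "r \<le> conjugate f j \<longleftrightarrow> j \<le> f r"
  unfolding conjugate_def
  by (rule le_card_down_closed_iff) (use assms in \<open>auto intro: order_trans\<close>)

lemma is_partition_zero: "is_partition \<alpha> \<Longrightarrow> \<alpha> 0 = 0"
  by (simp add: is_partition_def)

lemma is_partition_antimono:
  assumes "is_partition \<alpha>" and "1 \<le> r" and "r \<le> s"
  shows "\<alpha> s \<le> \<alpha> r"
  using assms(3) assms(1,2)
  by (induction rule: dec_induct) (auto simp: is_partition_def intro: order_trans)

lemma is_partition_le_conjugate_iff:
  assumes "is_partition \<alpha>" and "1 \<le> j" and "1 \<le> r"
  shows "r \<le> conjugate \<alpha> j \<longleftrightarrow> j \<le> \<alpha> r"
proof (rule le_conjugate_iff)
  have "{r. 1 \<le> r \<and> j \<le> \<alpha> r} \<subseteq> {r. \<alpha> r \<noteq> 0}" using assms(2) by auto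
  thus "finite {r. 1 \<le> r \<and> j \<le> \<alpha> r}"
    using assms(1) finite_subset unfolding is_partition_def by blast
qed (use assms is_partition_antimono in auto)

lemma conjugate_antimono:
  assumes "is_partition \<alpha>" and "1 \<le> j" and "j \<le> j'"
  shows "conjugate \<alpha> j' \<le> conjugate \<alpha> j"
  using is_partition_le_conjugate_iff[OF assms(1), of j' "conjugate \<alpha> j'"]
    is_partition_le_conjugate_iff[OF assms(1), of j "conjugate \<alpha> j'"] assms
  by (cases "conjugate \<alpha> j' = 0") auto

lemma plength_pos_iff:
  assumes "is_partition \<alpha>" and "1 \<le> r"
  shows "r \<le> plength \<alpha> \<longleftrightarrow> \<alpha> r \<noteq> 0"
proof -
  have "{r. \<alpha> r \<noteq> 0} = {r. 1 \<le> r \<and> 1 \<le> \<alpha> r}"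
    using is_partition_zero[OF assms(1)] by (auto simp: Suc_le_eq intro: gr0I)
  hence "plength \<alpha> = conjugate \<alpha> 1" by (simp add: plength_def conjugate_def)
  thus ?thesis using is_partition_le_conjugate_iff[OF assms(1), of 1 r] assms(2) by auto
qed

lemma diagram_eq_Sigma:
  "is_partition \<alpha> \<Longrightarrow> diagram \<alpha> = Sigma {i. \<alpha> i \<noteq> 0} (\<lambda>i. {1..\<alpha> i})"
  by (auto simp: diagram_def Suc_le_eq intro!: gr0I dest: is_partition_zero)

lemma finite_diagram: "is_partition \<alpha> \<Longrightarrow> finite (diagram \<alpha>)"
  unfolding diagram_eq_Sigma by (auto simp: is_partition_def)

lemma card_diagram: "is_partition \<alpha> \<Longrightarrow> card (diagram \<alpha>) = psize \<alpha>"
  unfolding diagram_eq_Sigma psize_def by (subst card_SigmaI) (auto simp: is_partition_def)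

lemma finite_skew_diagram: "is_partition \<alpha> \<Longrightarrow> finite (skew_diagram \<alpha> \<beta>)"
  by (simp add: skew_diagram_def finite_diagram)

lemma mem_skew_diagram_iff: "(r, j) \<in> skew_diagram \<alpha> \<beta> \<longleftrightarrow> 1 \<le> r \<and> \<beta> r < j \<and> j \<le> \<alpha> r"
  by (auto simp: skew_diagram_def diagram_def)

lemma skew_diagram_row_le_plength:
  assumes "is_partition \<alpha>" and "x \<in> skew_diagram \<alpha> \<beta>"
  shows "fst x \<le> plength \<alpha>"
  using assms plength_pos_iff[OF assms(1), of "fst x"]
  by (cases x) (auto simp: mem_skew_diagram_iff)

section \<open>Lattice words and row counts\<close>

definition entries_upto ::
    "(nat \<Rightarrow> nat) \<Rightarrow> (nat \<Rightarrow> nat) \<Rightarrow> (nat \<times> nat \<Rightarrow> nat) \<Rightarrow> nat \<Rightarrow> nat \<Rightarrow> nat" where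
  "entries_upto \<alpha> \<beta> T k s = card {x \<in> skew_diagram \<alpha> \<beta>. T x = k \<and> fst x \<le> s}"

definition reverse_row ::
    "(nat \<Rightarrow> nat) \<Rightarrow> (nat \<Rightarrow> nat) \<Rightarrow> (nat \<times> nat \<Rightarrow> nat) \<Rightarrow> nat \<Rightarrow> nat list" where
  "reverse_row \<alpha> \<beta> T i = rev (map (\<lambda>j. T (i, j)) [\<beta> i + 1..<\<alpha> i + 1])"

lemma count_list_map_distinct:
  "distinct xs \<Longrightarrow> count_list (map f xs) k = card {x \<in> set xs. f x = k}"
proof (induction xs)
  case (Cons a xs)
  have "{x \<in> set (a # xs). f x = k} = (if f a = k then {a} else {}) \<union> {x \<in> set xs. f x = k}"
    by auto
  thus ?case using Cons by auto
qed simp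

lemma count_list_reverse_row:
  "count_list (reverse_row \<alpha> \<beta> T i) k = card {j \<in> {\<beta> i + 1..\<alpha> i}. T (i, j) = k}"
proof -
  have "count_list (reverse_row \<alpha> \<beta> T i) k = count_list (map (\<lambda>j. T (i, j)) [\<beta> i + 1..<\<alpha> i + 1]) k"
    by (simp add: reverse_row_def)
  also have "\<dots> = card {j \<in> set [\<beta> i + 1..<\<alpha> i + 1]. T (i, j) = k}"
    by (rule count_list_map_distinct) simp
  finally show ?thesis by (simp add: atLeastLessThanSuc_atLeastAtMost del: upt_Suc)
qed

lemma count_list_rows:
  assumes "is_partition \<alpha>"
  shows "count_list (concat (map (reverse_row \<alpha> \<beta> T) [1..<s + 1])) k = entries_upto \<alpha> \<beta> T k s"
proof (induction s)
  case 0
  have "{x \<in> skew_diagram \<alpha> \<beta>. T x = k \<and> fst x \<le> 0} = {}"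
    by (auto simp: mem_skew_diagram_iff)
  thus ?case by (simp only: entries_upto_def) simp
next
  case (Suc s)
  let ?A = "{x \<in> skew_diagram \<alpha> \<beta>. T x = k \<and> fst x \<le> s}"
  let ?B = "Pair (Suc s) ` {j \<in> {\<beta> (Suc s) + 1..\<alpha> (Suc s)}. T (Suc s, j) = k}"
  have un: "{x \<in> skew_diagram \<alpha> \<beta>. T x = k \<and> fst x \<le> Suc s} = ?A \<union> ?B"
    by (auto simp: mem_skew_diagram_iff le_Suc_eq image_iff)
  have "entries_upto \<alpha> \<beta> T k (Suc s) = card (?A \<union> ?B)" by (simp only: entries_upto_def un)
  also have "\<dots> = card ?A + card ?B"
    using finite_skew_diagram[OF assms, of \<beta>] by (intro card_Un_disjoint) auto
  also have "card ?B = count_list (reverse_row \<alpha> \<beta> T (Suc s)) k"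
    by (simp only: count_list_reverse_row) (rule card_image, simp add: inj_on_def)
  finally show ?case using Suc by (simp add: entries_upto_def)
qed

lemma reverse_row_word_eq:
  "reverse_row_word \<alpha> \<beta> T = concat (map (reverse_row \<alpha> \<beta> T) [1..<plength \<alpha> + 1])"
  by (simp add: reverse_row_word_def reverse_row_def[abs_def])

text \<open>Prefixes as left factors, rather than as \<open>take m w\<close>, fit the splitting of
  the word into rows.\<close>

lemma lattice_word_iff_append:
  "lattice_word w \<longleftrightarrow> (\<forall>u v k. w = u @ v \<and> 1 \<le> k \<longrightarrow> count_list u (Suc k) \<le> count_list u k)"
proof
  assume w: "lattice_word w"
  show "\<forall>u v k. w = u @ v \<and> 1 \<le> k \<longrightarrow> count_list u (Suc k) \<le> count_list u k"
  proof (intro allI impI)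
    fix u v and k :: nat assume "w = u @ v \<and> 1 \<le> k"
    moreover from this have "take (length u) w = u" "length u \<le> length w" by auto
    ultimately show "count_list u (Suc k) \<le> count_list u k"
      using w unfolding lattice_word_def by metis
  qed
next
  assume *: "\<forall>u v k. w = u @ v \<and> 1 \<le> k \<longrightarrow> count_list u (Suc k) \<le> count_list u k"
  show "lattice_word w" unfolding lattice_word_def
    using * append_take_drop_id by metis
qed

text \<open>A prefix ends inside some row s + 1. The worst case counts every k + 1 of that row and
  no k of it, and this is what \<open>step\<close> controls.\<close>

lemma lattice_wordI:
  assumes "is_partition \<alpha>"
    and step: "\<And>k s. 1 \<le> k \<Longrightarrow> entries_upto \<alpha> \<beta> T (Suc k) (Suc s) \<le> entries_upto \<alpha> \<beta> T k s"
  shows "lattice_word (reverse_row_word \<alpha> \<beta> T)"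
  unfolding lattice_word_iff_append
proof (intro allI impI, elim conjE)
  fix u v and k :: nat
  assume w: "reverse_row_word \<alpha> \<beta> T = u @ v" and k: "1 \<le> k"
  let ?R = "reverse_row \<alpha> \<beta> T"
  show "count_list u (Suc k) \<le> count_list u k"
  proof (cases "map ?R [1..<plength \<alpha> + 1] = []")
    case True
    thus ?thesis using w unfolding reverse_row_word_eq True by simp
  next
    case False
    from w[unfolded reverse_row_word_eq] False obtain xss1 xs xs' xss2
      where dec: "map ?R [1..<plength \<alpha> + 1] = xss1 @ (xs @ xs') # xss2" and u: "u = concat xss1 @ xs"
      unfolding concat_eq_append_conv by auto
    define s where "s = length xss1"
    have len: "s < plength \<alpha>" using arg_cong[OF dec, of length] by (simp add: s_def del: upt_Suc)
    have "xss1 = take s (map ?R [1..<plength \<alpha> + 1])" unfolding dec by (simp add: s_def)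
    hence x1: "xss1 = map ?R [1..<s + 1]" using len
      by (simp add: take_map del: upt_Suc) 
    have "xs @ xs' = map ?R [1..<plength \<alpha> + 1] ! s" unfolding dec by (simp add: s_def)
    hence x2: "?R (Suc s) = xs @ xs'" using len by (simp del: upt_Suc)
    have "count_list u (Suc k) \<le> count_list (concat xss1 @ xs @ xs') (Suc k)" by (simp add: u)
    also have "concat xss1 @ xs @ xs' = concat (map ?R [1..<Suc s + 1])" by (simp add: x1 x2)
    also have "count_list \<dots> (Suc k) \<le> entries_upto \<alpha> \<beta> T k s"
      unfolding count_list_rows[OF assms(1)] by (rule step[OF k])
    also have "\<dots> = count_list (concat xss1) k" unfolding x1 count_list_rows[OF assms(1)] ..
    also have "\<dots> \<le> count_list u k" by (simp add: u)
    finally show ?thesis .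
  qed
qed

text \<open>Matching each k + 1 with a k in a strictly higher row handles all s at once, since the
  matching restricts to the first s + 1 rows.\<close>

lemma lattice_wordI_injection:
  assumes "is_partition \<alpha>"
    and "\<And>k. 1 \<le> k \<Longrightarrow> inj_on (g k) {x \<in> skew_diagram \<alpha> \<beta>. T x = Suc k}"
    and "\<And>k x. 1 \<le> k \<Longrightarrow> x \<in> skew_diagram \<alpha> \<beta> \<Longrightarrow> T x = Suc k \<Longrightarrow>
      g k x \<in> skew_diagram \<alpha> \<beta> \<and> T (g k x) = k \<and> fst (g k x) < fst x"
  shows "lattice_word (reverse_row_word \<alpha> \<beta> T)"
proof (rule lattice_wordI[OF assms(1)])
  fix k s :: nat assume k: "1 \<le> k"
  show "entries_upto \<alpha> \<beta> T (Suc k) (Suc s) \<le> entries_upto \<alpha> \<beta> T k s"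
    unfolding entries_upto_def
  proof (rule card_inj_on_le)
    show "inj_on (g k) {x \<in> skew_diagram \<alpha> \<beta>. T x = Suc k \<and> fst x \<le> Suc s}"
      by (rule inj_on_subset[OF assms(2)[OF k]]) auto
    show "g k ` {x \<in> skew_diagram \<alpha> \<beta>. T x = Suc k \<and> fst x \<le> Suc s}
        \<subseteq> {x \<in> skew_diagram \<alpha> \<beta>. T x = k \<and> fst x \<le> s}"
      using assms(3)[OF k] by fastforce
  qed (simp add: finite_skew_diagram[OF assms(1)])
qed

lemma semistandard_row_mono:
  "semistandard \<alpha> \<beta> T \<Longrightarrow> (i, j) \<in> skew_diagram \<alpha> \<beta> \<Longrightarrow> (i, j') \<in> skew_diagram \<alpha> \<beta> \<Longrightarrow>
    j \<le> j' \<Longrightarrow> T (i, j) \<le> T (i, j')"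
  unfolding semistandard_def by (cases "j = j'") auto

text \<open>Columns increase strictly, so equal entries lie in different columns. Multiplicities can
  thus be bounded by counting columns.\<close>

lemma semistandard_inj_on_snd:
  assumes "semistandard \<alpha> \<beta> T"
  shows "inj_on snd {x \<in> skew_diagram \<alpha> \<beta>. T x = k}"
proof -
  have "T (i, j) < T (i', j)"
    if "(i, j) \<in> skew_diagram \<alpha> \<beta>" "(i', j) \<in> skew_diagram \<alpha> \<beta>" "i < i'" for i i' j
    using assms that unfolding semistandard_def by blast
  hence *: "i = i'" if "(i, j) \<in> skew_diagram \<alpha> \<beta>" "(i', j) \<in> skew_diagram \<alpha> \<beta>" "T (i, j) = T (i', j)" for i i' j
    using that by (metis less_irrefl linorder_neqE_nat)
  show ?thesis
  proof (rule inj_onI)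
    fix x y
    assume "x \<in> {x \<in> skew_diagram \<alpha> \<beta>. T x = k}" "y \<in> {x \<in> skew_diagram \<alpha> \<beta>. T x = k}" "snd x = snd y"
    thus "x = y" using *[of "fst x" "snd x" "fst y"] by (cases x, cases y) simp
  qed
qed

text \<open>In the word of a row read from right to left, the entries greater than \<open>k\<close> come first; cutting
  the word just after them gives the inequality.\<close>

lemma lattice_word_step:
  assumes "is_partition \<alpha>" and ss: "semistandard \<alpha> \<beta> T"
    and lat: "lattice_word (reverse_row_word \<alpha> \<beta> T)" and k: "1 \<le> k"
  shows "entries_upto \<alpha> \<beta> T (Suc k) (Suc s) \<le> entries_upto \<alpha> \<beta> T k s"
proof (cases "s < plength \<alpha>")
  case True
  let ?R = "reverse_row \<alpha> \<beta> T"
  define u where "u = takeWhile (\<lambda>a. k < a) (?R (Suc s))"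
  define v where "v = dropWhile (\<lambda>a. k < a) (?R (Suc s))"
  have uv: "?R (Suc s) = u @ v" by (simp add: u_def v_def)
  have "map ?R [1..<plength \<alpha> + 1] = map ?R ([1..<s + 1] @ Suc s # [Suc (Suc s)..<plength \<alpha> + 1])"
    using True upt_add_eq_append[of 1 "s + 1" "plength \<alpha> - s"] upt_conv_Cons[of "Suc s" "plength \<alpha> + 1"]
    by (simp del: upt_Suc)
  hence "reverse_row_word \<alpha> \<beta> T = (concat (map ?R [1..<s + 1]) @ u)
      @ (v @ concat (map ?R [Suc (Suc s)..<plength \<alpha> + 1]))"
    unfolding reverse_row_word_eq by (simp only: map_append concat_append list.map concat.simps uv append_assoc)
  with lat k have le: "count_list (concat (map ?R [1..<s + 1]) @ u) (Suc k)
      \<le> count_list (concat (map ?R [1..<s + 1]) @ u) k"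
    unfolding lattice_word_iff_append by blast
  have "k \<notin> set u" unfolding u_def by (auto dest: set_takeWhileD)
  hence u: "count_list u k = 0" by (simp add: count_list_0_iff)
  \<comment> \<open>Once an entry at most k has been read, the rest of the row stays at most k;
    hence \<open>v\<close> contains no k + 1.\<close>
  have "sorted_wrt (\<ge>) (?R (Suc s))"
    unfolding reverse_row_def sorted_wrt_rev
    unfolding sorted_wrt_map
    by (rule sorted_wrt_mono_rel[of _ "(<)"])
      (auto simp del: upt_Suc intro!: semistandard_row_mono[OF ss] simp: mem_skew_diagram_iff)
  hence "sorted_wrt (\<ge>) v" by (simp add: uv sorted_wrt_append)
  have "Suc k \<notin> set v"
  proof
    assume "Suc k \<in> set v"
    then obtain a w where v: "v = a # w" by (cases v) auto
    have "\<not> k < a" using v hd_dropWhile[of "\<lambda>a. k < a" "?R (Suc s)"] unfolding v_def by auto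
    moreover have "Suc k \<le> a" using \<open>Suc k \<in> set v\<close> \<open>sorted_wrt (\<ge>) v\<close> v by auto
    ultimately show False by simp
  qed
  hence v: "count_list v (Suc k) = 0" by (simp add: count_list_0_iff)
  have "entries_upto \<alpha> \<beta> T (Suc k) (Suc s) = count_list (concat (map ?R [1..<Suc s + 1])) (Suc k)"
    by (rule count_list_rows[OF assms(1), symmetric])
  also have "\<dots> = count_list (concat (map ?R [1..<s + 1]) @ u) (Suc k)"
    using v by (simp add: uv)
  also note le
  also have "count_list (concat (map ?R [1..<s + 1]) @ u) k = entries_upto \<alpha> \<beta> T k s"
    using count_list_rows[OF assms(1), of \<beta> T s k] u by simp
  finally show ?thesis .
next
  case False
  \<comment> \<open>Beyond the last row both counts cover the whole filling, and the lattice
    property of the full word suffices.\<close>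
  have *: "entries_upto \<alpha> \<beta> T k t = count_list (reverse_row_word \<alpha> \<beta> T) k" if "plength \<alpha> \<le> t" for k t
  proof -
    have "{x \<in> skew_diagram \<alpha> \<beta>. T x = k \<and> fst x \<le> t}
        = {x \<in> skew_diagram \<alpha> \<beta>. T x = k \<and> fst x \<le> plength \<alpha>}"
      using skew_diagram_row_le_plength[OF assms(1)] that by fastforce
    thus ?thesis unfolding reverse_row_word_eq count_list_rows[OF assms(1)] entries_upto_def by simp
  qed
  have "count_list (reverse_row_word \<alpha> \<beta> T) (Suc k) \<le> count_list (reverse_row_word \<alpha> \<beta> T) k"
    using lat k unfolding lattice_word_iff_append by (metis append_Nil2)
  thus ?thesis using False by (simp add: *)
qed

section \<open>Littlewood--Richardson fillings\<close>

text \<open>The content is left out: the arguments control one multiplicity at a time, and the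
  others need not be known.\<close>

definition lr_filling :: "(nat \<Rightarrow> nat) \<Rightarrow> (nat \<Rightarrow> nat) \<Rightarrow> (nat \<times> nat \<Rightarrow> nat) \<Rightarrow> bool" where
  "lr_filling \<alpha> \<beta> T \<longleftrightarrow> semistandard \<alpha> \<beta> T \<and> lattice_word (reverse_row_word \<alpha> \<beta> T)"

text \<open>The source of all upper bounds: s = 0 shows that an entry cannot exceed its row, and k =
  1 reduces the count of any entry to a count of ones.\<close>

lemma lr_filling_shift:
  assumes "is_partition \<alpha>" and "lr_filling \<alpha> \<beta> T" and "1 \<le> k"
  shows "entries_upto \<alpha> \<beta> T (k + d) (s + d) \<le> entries_upto \<alpha> \<beta> T k s"
proof (induction d)
  case (Suc d)
  have "entries_upto \<alpha> \<beta> T (Suc (k + d)) (Suc (s + d)) \<le> entries_upto \<alpha> \<beta> T (k + d) (s + d)"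
    using lattice_word_step[OF assms(1)] assms(2,3) unfolding lr_filling_def by simp
  thus ?case using Suc by simp
qed simp

text \<open>Moving an entry larger than its row r up by r rows would force a positive entry into the
  empty row 0.\<close>

lemma lr_filling_entry_le_row:
  assumes "is_partition \<alpha>" and "lr_filling \<alpha> \<beta> T" and x: "(r, j) \<in> skew_diagram \<alpha> \<beta>"
  shows "T (r, j) \<le> r"
proof (rule ccontr)
  assume "\<not> T (r, j) \<le> r"
  then obtain d where d: "T (r, j) = (1 + d) + r"
    by (metis add.commute add_Suc_right less_imp_Suc_add not_le plus_1_eq_Suc)
  have "entries_upto \<alpha> \<beta> T (T (r, j)) r \<le> entries_upto \<alpha> \<beta> T (1 + d) 0"
    using lr_filling_shift[OF assms(1,2), of "1 + d" r 0] by (simp add: d)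
  also have "\<dots> = 0"
    by (auto simp: entries_upto_def mem_skew_diagram_iff card_eq_0_iff)
  finally show False using x finite_skew_diagram[OF assms(1), of \<beta>]
    by (auto simp: entries_upto_def card_eq_0_iff)
qed

text \<open>Entries k lie in rows from k on, hence in the first \<open>\<alpha> k\<close> columns,
  at most one per column. This gives one bound for the base and one for the cover.\<close>

lemma lr_filling_content_le:
  assumes "is_partition \<alpha>" and lr: "lr_filling \<alpha> \<beta> T" and "1 \<le> k"
  shows "card {x \<in> skew_diagram \<alpha> \<beta>. T x = k} \<le> \<alpha> k"
proof -
  have "card {x \<in> skew_diagram \<alpha> \<beta>. T x = k} \<le> card {1..\<alpha> k}"
  proof (rule card_inj_on_le)
    show "inj_on snd {x \<in> skew_diagram \<alpha> \<beta>. T x = k}"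
      using lr by (simp add: lr_filling_def semistandard_inj_on_snd)
    show "snd ` {x \<in> skew_diagram \<alpha> \<beta>. T x = k} \<subseteq> {1..\<alpha> k}"
    proof clarify
      fix r j assume x: "(r, j) \<in> skew_diagram \<alpha> \<beta>" and k: "k = T (r, j)"
      show "snd (r, j) \<in> {1..\<alpha> (T (r, j))}"
        using x is_partition_antimono[OF assms(1,3), of r] lr_filling_entry_le_row[OF assms(1,2) x]
        unfolding k by (auto simp: mem_skew_diagram_iff)
    qed
  qed simp
  thus ?thesis by simp
qed

text \<open>Shifting by k - 1 compares the entries k in all rows with the ones in the first
  \<open>m\<close> rows. Those ones lie in different columns, all to the right of
  \<open>\<beta> m\<close>.\<close>

lemma lr_filling_content_le_diff:
  assumes \<alpha>: "is_partition \<alpha>" and \<beta>: "is_partition \<beta>" and lr: "lr_filling \<alpha> \<beta> T"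
    and k: "1 \<le> k" "k \<le> plength \<alpha>"
  shows "card {x \<in> skew_diagram \<alpha> \<beta>. T x = k} \<le> \<alpha> 1 - \<beta> (plength \<alpha> + 1 - k)"
proof -
  define m where "m = plength \<alpha> + 1 - k"
  have m: "1 \<le> m" "plength \<alpha> = m + (k - 1)" using k by (auto simp: m_def)
  have "{x \<in> skew_diagram \<alpha> \<beta>. T x = k} = {x \<in> skew_diagram \<alpha> \<beta>. T x = k \<and> fst x \<le> plength \<alpha>}"
    using skew_diagram_row_le_plength[OF \<alpha>, of _ \<beta>] by blast
  hence "card {x \<in> skew_diagram \<alpha> \<beta>. T x = k} = entries_upto \<alpha> \<beta> T k (plength \<alpha>)"
    by (simp only: entries_upto_def)
  also have "\<dots> = entries_upto \<alpha> \<beta> T (1 + (k - 1)) (m + (k - 1))"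
    using k m(2) by simp
  also have "\<dots> \<le> entries_upto \<alpha> \<beta> T 1 m" by (rule lr_filling_shift[OF \<alpha> lr]) simp
  also have "\<dots> \<le> card {\<beta> m + 1..\<alpha> 1}" unfolding entries_upto_def
  proof (rule card_inj_on_le)
    have "inj_on snd {x \<in> skew_diagram \<alpha> \<beta>. T x = 1}"
      using lr by (simp add: lr_filling_def semistandard_inj_on_snd)
    thus "inj_on snd {x \<in> skew_diagram \<alpha> \<beta>. T x = 1 \<and> fst x \<le> m}"
      by (rule inj_on_subset) auto
    show "snd ` {x \<in> skew_diagram \<alpha> \<beta>. T x = 1 \<and> fst x \<le> m} \<subseteq> {\<beta> m + 1..\<alpha> 1}"
    proof clarify
      fix r j assume x: "(r, j) \<in> skew_diagram \<alpha> \<beta>" and r: "fst (r, j) \<le> m"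
      show "snd (r, j) \<in> {\<beta> m + 1..\<alpha> 1}"
        using x r is_partition_antimono[OF \<alpha>, of 1 r] is_partition_antimono[OF \<beta>, of r m]
        by (auto simp: mem_skew_diagram_iff)
    qed
  qed simp
  finally show ?thesis by (simp add: m_def)
qed

text \<open>An infinite set has \<open>card\<close> 0, so finiteness is what lets a single filling
  make the coefficient nonzero. The entries range over the support of \<nu>.\<close>

lemma finite_lr_fillings:
  assumes "is_partition \<alpha>" and "is_partition \<nu>"
  shows "finite {T. semistandard \<alpha> \<mu> T \<and> has_content \<alpha> \<mu> T \<nu> \<and>
      lattice_word (reverse_row_word \<alpha> \<mu> T)}"
proof (rule finite_subset)
  have fin: "finite {k. \<nu> k \<noteq> 0}" using assms(2) by (simp add: is_partition_def)
  let ?F = "{T. \<forall>x. (x \<in> skew_diagram \<alpha> \<mu> \<longrightarrow> T x \<in> {k. \<nu> k \<noteq> 0}) \<and> (x \<notin> skew_diagram \<alpha> \<mu> \<longrightarrow> T x = 0)}"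
  show "finite ?F"
    by (rule finite_set_of_finite_funs[OF finite_skew_diagram[OF assms(1)] fin])
  show "{T. semistandard \<alpha> \<mu> T \<and> has_content \<alpha> \<mu> T \<nu> \<and> lattice_word (reverse_row_word \<alpha> \<mu> T)} \<subseteq> ?F"
  proof (intro subsetI CollectI allI conjI impI)
    fix T y
    assume "T \<in> {T. semistandard \<alpha> \<mu> T \<and> has_content \<alpha> \<mu> T \<nu> \<and> lattice_word (reverse_row_word \<alpha> \<mu> T)}"
    hence ss: "semistandard \<alpha> \<mu> T" and c: "has_content \<alpha> \<mu> T \<nu>" by auto
    show "T y = 0" if "y \<notin> skew_diagram \<alpha> \<mu>"
      using ss that unfolding semistandard_def by blast
    assume y: "y \<in> skew_diagram \<alpha> \<mu>"
    hence "1 \<le> T y" using ss unfolding semistandard_def by blast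
    hence "card {x \<in> skew_diagram \<alpha> \<mu>. T x = T y} = \<nu> (T y)"
      using c unfolding has_content_def by blast
    moreover have "card {x \<in> skew_diagram \<alpha> \<mu>. T x = T y} \<noteq> 0"
      using y finite_skew_diagram[OF assms(1), of \<mu>] by (cases y) (auto simp: card_eq_0_iff)
    ultimately show "\<nu> (T y) \<noteq> 0" by simp
  qed
qed

lemma lr_coeff_nonzero_iff:
  assumes "is_partition \<alpha>" and "is_partition \<nu>"
  shows "lr_coeff \<alpha> \<mu> \<nu> \<noteq> 0 \<longleftrightarrow>
    diagram \<mu> \<subseteq> diagram \<alpha> \<and> (\<exists>T. lr_filling \<alpha> \<mu> T \<and> has_content \<alpha> \<mu> T \<nu>)"
proof (cases "diagram \<mu> \<subseteq> diagram \<alpha>")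
  case True
  hence "lr_coeff \<alpha> \<mu> \<nu> \<noteq> 0 \<longleftrightarrow> {T. semistandard \<alpha> \<mu> T \<and> has_content \<alpha> \<mu> T \<nu> \<and>
      lattice_word (reverse_row_word \<alpha> \<mu> T)} \<noteq> {}"
    using finite_lr_fillings[OF assms, of \<mu>] unfolding lr_coeff_def
    by (simp only: if_True card_eq_0_iff simp_thms not_not)
  thus ?thesis using True unfolding lr_filling_def by blast
qed (simp add: lr_coeff_def)

text \<open>Needed to see that restricting the character sums to one size loses no
  constituent.\<close>

lemma card_skew_diagram_content:
  assumes \<alpha>: "is_partition \<alpha>" and \<nu>: "is_partition \<nu>"
    and ss: "semistandard \<alpha> \<mu> T" and c: "has_content \<alpha> \<mu> T \<nu>"
  shows "card (skew_diagram \<alpha> \<mu>) = psize \<nu>"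
proof -
  let ?D = "skew_diagram \<alpha> \<mu>"
  have fin: "finite ?D" by (rule finite_skew_diagram[OF \<alpha>])
  have pos: "1 \<le> T x" if "x \<in> ?D" for x using ss that by (auto simp: semistandard_def)
  have sub: "T ` ?D \<subseteq> {k. \<nu> k \<noteq> 0}"
  proof (intro image_subsetI CollectI)
    fix y assume y: "y \<in> ?D"
    have "card {x \<in> ?D. T x = T y} = \<nu> (T y)" using c pos[OF y] unfolding has_content_def by blast
    moreover have "card {x \<in> ?D. T x = T y} \<noteq> 0" using y fin by (cases y) (auto simp: card_eq_0_iff)
    ultimately show "\<nu> (T y) \<noteq> 0" by simp
  qed
  have "card ?D = (\<Sum>x\<in>?D. 1)" by simp
  also have "\<dots> = (\<Sum>k | \<nu> k \<noteq> 0. \<Sum>x | x \<in> ?D \<and> T x = k. 1)"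
    using \<nu> by (intro sum.group[symmetric] fin sub) (simp add: is_partition_def)
  also have "\<dots> = (\<Sum>k | \<nu> k \<noteq> 0. \<nu> k)"
  proof (rule sum.cong)
    fix k assume "k \<in> {k. \<nu> k \<noteq> 0}"
    hence "1 \<le> k" using is_partition_zero[OF \<nu>] by (cases "k = 0") auto
    thus "(\<Sum>x | x \<in> ?D \<and> T x = k. 1) = \<nu> k" using c by (simp add: has_content_def)
  qed simp
  finally show ?thesis by (simp add: psize_def)
qed

lemma psize_eq_add:
  assumes "is_partition \<alpha>" and "is_partition \<mu>" and "diagram \<mu> \<subseteq> diagram \<alpha>"
  shows "psize \<alpha> = psize \<mu> + card (skew_diagram \<alpha> \<mu>)"
  using card_mono[OF finite_diagram[OF assms(1)] assms(3)] assms
  by (simp add: skew_diagram_def card_Diff_subset finite_diagram card_diagram)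

lemma keys_outer_prod:
  assumes "is_partition \<mu>" and "is_partition \<kappa>"
  shows "\<rho> \<in> Poly_Mapping.keys (outer_prod \<mu> \<kappa>) \<longleftrightarrow> is_partition \<rho> \<and> diagram \<mu> \<subseteq> diagram \<rho> \<and>
    (\<exists>T. lr_filling \<rho> \<mu> T \<and> has_content \<rho> \<mu> T \<kappa>)"
proof -
  have "psize \<rho> = psize \<mu> + psize \<kappa>"
    if "is_partition \<rho>" "diagram \<mu> \<subseteq> diagram \<rho>" "lr_filling \<rho> \<mu> T" "has_content \<rho> \<mu> T \<kappa>" for T
    using psize_eq_add[OF that(1) assms(1) that(2)] that(3,4)
      card_skew_diagram_content[OF that(1) assms(2), of \<mu> T] by (simp add: lr_filling_def)
  thus ?thesis
    using lr_coeff_nonzero_iff[OF _ assms(2), of \<rho> \<mu>]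
    by (auto simp: in_keys_iff lookup_outer_prod partitions_of_def)
qed

lemma keys_skew_char:
  assumes "is_partition \<alpha>" and "is_partition \<mu>" and "diagram \<mu> \<subseteq> diagram \<alpha>"
  shows "\<nu> \<in> Poly_Mapping.keys (skew_char \<alpha> \<mu>) \<longleftrightarrow> is_partition \<nu> \<and>
    (\<exists>T. lr_filling \<alpha> \<mu> T \<and> has_content \<alpha> \<mu> T \<nu>)"
proof -
  have "psize \<nu> = psize \<alpha> - psize \<mu>"
    if "is_partition \<nu>" "lr_filling \<alpha> \<mu> T" "has_content \<alpha> \<mu> T \<nu>" for T
    using psize_eq_add[OF assms] that(2,3)
      card_skew_diagram_content[OF assms(1) that(1), of \<mu> T] by (simp add: lr_filling_def)
  thus ?thesis
    using lr_coeff_nonzero_iff[OF assms(1), of \<nu> \<mu>] assms(3)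
    by (auto simp: in_keys_iff lookup_skew_char partitions_of_def)
qed

text \<open>The lattice property of the full word makes the multiplicities decrease, so every
  filling yields a constituent without its content being computed.\<close>

lemma lr_filling_content_in_keys:
  assumes "is_partition \<alpha>" and "is_partition \<mu>" and "diagram \<mu> \<subseteq> diagram \<alpha>" and lr: "lr_filling \<alpha> \<mu> T"
  shows "(\<lambda>k. if k = 0 then 0 else card {x \<in> skew_diagram \<alpha> \<mu>. T x = k}) \<in> Poly_Mapping.keys (skew_char \<alpha> \<mu>)"
    (is "?\<nu> \<in> _")
proof -
  have fin: "finite (skew_diagram \<alpha> \<mu>)" by (rule finite_skew_diagram[OF assms(1)])
  have all: "entries_upto \<alpha> \<mu> T k s = card {x \<in> skew_diagram \<alpha> \<mu>. T x = k}"
    if "plength \<alpha> \<le> s" for k s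
  proof -
    have "{x \<in> skew_diagram \<alpha> \<mu>. T x = k \<and> fst x \<le> s} = {x \<in> skew_diagram \<alpha> \<mu>. T x = k}"
      using that skew_diagram_row_le_plength[OF assms(1)] by fastforce
    thus ?thesis by (simp add: entries_upto_def)
  qed
  have "{k. ?\<nu> k \<noteq> 0} \<subseteq> T ` skew_diagram \<alpha> \<mu>"
  proof
    fix k assume "k \<in> {k. ?\<nu> k \<noteq> 0}"
    hence "card {x \<in> skew_diagram \<alpha> \<mu>. T x = k} \<noteq> 0" by (auto split: if_splits)
    hence "{x \<in> skew_diagram \<alpha> \<mu>. T x = k} \<noteq> {}" by (metis card.empty)
    thus "k \<in> T ` skew_diagram \<alpha> \<mu>" by blast
  qed
  hence "finite {k. ?\<nu> k \<noteq> 0}" using fin by (meson finite_imageI finite_subset)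
  moreover have "?\<nu> (Suc k) \<le> ?\<nu> k" if "1 \<le> k" for k
    using lr_filling_shift[OF assms(1) lr that, of 1 "plength \<alpha>"] that by (simp add: all)
  ultimately have "is_partition ?\<nu>" by (simp add: is_partition_def)
  moreover have "has_content \<alpha> \<mu> T ?\<nu>" by (simp add: has_content_def)
  ultimately show ?thesis using lr unfolding keys_skew_char[OF assms(1-3)] by blast
qed


lemma semistandardI:
  assumes "\<And>r j. (r, j) \<notin> skew_diagram \<alpha> \<beta> \<Longrightarrow> T (r, j) = 0"
    and "\<And>r j. (r, j) \<in> skew_diagram \<alpha> \<beta> \<Longrightarrow> 1 \<le> T (r, j)"
    and "\<And>r j j'. (r, j) \<in> skew_diagram \<alpha> \<beta> \<Longrightarrow> (r, j') \<in> skew_diagram \<alpha> \<beta> \<Longrightarrow> j < j' \<Longrightarrow>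
      T (r, j) \<le> T (r, j')"
    and "\<And>r r' j. (r, j) \<in> skew_diagram \<alpha> \<beta> \<Longrightarrow> (r', j) \<in> skew_diagram \<alpha> \<beta> \<Longrightarrow> r < r' \<Longrightarrow>
      T (r, j) < T (r', j)"
  shows "semistandard \<alpha> \<beta> T"
  using assms unfolding semistandard_def split_paired_All split_paired_Ball_Sigma by (auto simp: Ball_def)

section \<open>The base partition of an outer product\<close>

text \<open>Only positive j are compared, because the exchange of rows and columns holds from index
  1 on.\<close>

lemma nat_eqI_pos:
  fixes a b :: nat
  assumes "\<And>j. 1 \<le> j \<Longrightarrow> j \<le> a \<longleftrightarrow> j \<le> b"
  shows "a = b"
  using assms[of a] assms[of b] by (cases "a = 0"; cases "b = 0") auto

text \<open>To minimise part \<open>p + 1\<close>, put \<open>\<kappa>\<close> next to \<open>\<mu>\<close> in the first \<open>p\<close> rows, and below them sort the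
  remaining parts of \<open>\<mu>\<close> and \<open>\<kappa>\<close> together, that is, add up the column lengths.\<close>

lemma outer_prod_key_with_part_max:
  assumes \<mu>: "is_partition \<mu>" and \<kappa>: "is_partition \<kappa>"
  shows "\<exists>\<rho>\<in>Poly_Mapping.keys (outer_prod \<mu> \<kappa>). \<rho> (Suc p) = max (\<mu> (Suc p)) (\<kappa> (Suc p))"
proof -
  \<comment> \<open>\<open>M j\<close> and \<open>K j\<close> are the column lengths of \<mu> and
    \<kappa> below row p. Their sum, with p added for the upper rows, gives the columns that
    \<open>\<rho>\<close> turns back into rows.\<close>
  define M where "M j = conjugate \<mu> j - p" for j
  define K where "K j = conjugate \<kappa> j - p" for j
  define h where "h j = p + M j + K j" for j
  define \<rho> where "\<rho> r = (if r = 0 then 0 else if r \<le> p then \<mu> r + \<kappa> r else conjugate h r)" for r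
  define D where "D = skew_diagram \<rho> \<mu>"
  \<comment> \<open>Below row p, column j of \<open>D\<close> starts in row p + \<open>M j\<close> +
    1, so \<open>r - M j\<close> makes it read p + 1, p + 2, ...\<close>
  define T where "T = (\<lambda>(r, j). if (r, j) \<in> D then if r \<le> p then r else r - M j else 0)"
  note conj\<mu> = is_partition_le_conjugate_iff[OF \<mu>]
  note conj\<kappa> = is_partition_le_conjugate_iff[OF \<kappa>]
  have M_antimono: "M j' \<le> M j" if "1 \<le> j" "j \<le> j'" for j j'
    unfolding M_def by (rule diff_le_mono) (rule conjugate_antimono[OF \<mu> that])
  have K_antimono: "K j' \<le> K j" if "1 \<le> j" "j \<le> j'" for j j'
    unfolding K_def by (rule diff_le_mono) (rule conjugate_antimono[OF \<kappa> that])
  \<comment> \<open>The origin of the maximum: the sum of \<open>M j\<close> and \<open>K j\<close>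
    is positive as soon as one of them is.\<close>
  have h_max: "Suc p \<le> h j \<longleftrightarrow> j \<le> max (\<mu> (Suc p)) (\<kappa> (Suc p))" if "1 \<le> j" for j
  proof -
    have "Suc p \<le> h j \<longleftrightarrow> Suc p \<le> conjugate \<mu> j \<or> Suc p \<le> conjugate \<kappa> j"
      unfolding h_def M_def K_def by arith
    thus ?thesis using conj\<mu>[OF that, of "Suc p"] conj\<kappa>[OF that, of "Suc p"] by auto
  qed
  have \<rho>_iff: "j \<le> \<rho> r \<longleftrightarrow> r \<le> h j" if "p < r" "1 \<le> j" for r j
  proof -
    have "finite {j. 1 \<le> j \<and> r \<le> h j}"
    proof (rule finite_subset)
      show "{j. 1 \<le> j \<and> r \<le> h j} \<subseteq> {..max (\<mu> (Suc p)) (\<kappa> (Suc p))}"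
        using h_max that(1) by fastforce
    qed simp
    moreover have "h s \<le> h q" if "1 \<le> q" "q \<le> s" for q s
      unfolding h_def using M_antimono[OF that] K_antimono[OF that] by linarith
    ultimately show ?thesis using that by (simp add: \<rho>_def le_conjugate_iff)
  qed
  have \<rho>_max: "\<rho> (Suc p) = max (\<mu> (Suc p)) (\<kappa> (Suc p))"
    by (rule nat_eqI_pos) (simp only: \<rho>_iff[OF lessI] h_max)
  have \<rho>: "is_partition \<rho>"
    unfolding is_partition_def
  proof (intro conjI allI impI)
    show "\<rho> 0 = 0" by (simp add: \<rho>_def)
    show "\<rho> (Suc r) \<le> \<rho> r" if r: "1 \<le> r" for r
    proof -
      have step: "\<mu> (Suc r) \<le> \<mu> r" "\<kappa> (Suc r) \<le> \<kappa> r"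
        using is_partition_antimono[OF \<mu> r] is_partition_antimono[OF \<kappa> r] by auto
      consider "Suc r \<le> p" | "r = p" | "p < r" by linarith
      thus ?thesis
      proof cases
        case 1
        thus ?thesis using r step by (simp add: \<rho>_def)
      next
        case 2
        have "\<rho> r = \<mu> r + \<kappa> r" using 2 r by (simp add: \<rho>_def)
        thus ?thesis using \<rho>_max step unfolding 2 by simp
      next
        case 3
        show ?thesis
        proof (cases "\<rho> (Suc r) = 0")
          case False
          thus ?thesis using \<rho>_iff[of "Suc r" "\<rho> (Suc r)"] \<rho>_iff[of r "\<rho> (Suc r)"] 3 by simp
        qed simp
      qed
    qed
    show "finite {i. \<rho> i \<noteq> 0}"
    proof (rule finite_subset)
      show "{i. \<rho> i \<noteq> 0} \<subseteq> {..max p (h 1)}"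
      proof
        fix i assume "i \<in> {i. \<rho> i \<noteq> 0}"
        thus "i \<in> {..max p (h 1)}" using \<rho>_iff[of i 1] by (cases "p < i") auto
      qed
    qed simp
  qed
  have D_row: "(r, j) \<in> D \<longleftrightarrow> 1 \<le> r \<and> \<mu> r < j \<and> j \<le> \<mu> r + \<kappa> r" if "r \<le> p" for r j
    using that by (auto simp: D_def mem_skew_diagram_iff \<rho>_def)
  have D_col: "(r, j) \<in> D \<longleftrightarrow> p + M j < r \<and> r \<le> p + M j + K j" if "p < r" "1 \<le> j" for r j
  proof -
    have "\<mu> r < j \<longleftrightarrow> conjugate \<mu> j < r" using conj\<mu>[of j r] that by auto
    also have "\<dots> \<longleftrightarrow> p + M j < r" unfolding M_def using that by arith
    finally show ?thesis
      using \<rho>_iff[OF that] that by (auto simp: D_def mem_skew_diagram_iff h_def)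
  qed
  have D_pos: "1 \<le> r" "1 \<le> j" if "(r, j) \<in> D" for r j
    using that by (auto simp: D_def mem_skew_diagram_iff)
  have T_row: "T (r, j) = r" if "(r, j) \<in> D" "r \<le> p" for r j
    using that by (simp add: T_def)
  have T_col: "T (r, j) = r - M j" if "(r, j) \<in> D" "p < r" for r j
    using that by (simp add: T_def)
  have T_gt: "p < T (r, j)" if "(r, j) \<in> D" "p < r" for r j
    using T_col[OF that] D_col[OF that(2) D_pos(2)[OF that(1)]] that(1) by linarith
  have T_le_row: "T (r, j) \<le> r" for r j by (simp add: T_def)
  have ss: "semistandard \<rho> \<mu> T"
  proof (rule semistandardI; fold D_def)
    show "T (r, j) = 0" if "(r, j) \<notin> D" for r j using that by (simp add: T_def)
    show "1 \<le> T (r, j)" if "(r, j) \<in> D" for r j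
      using T_row[OF that] T_gt[OF that] D_pos[OF that] by (cases "r \<le> p") auto
    show "T (r, j) \<le> T (r, j')" if "(r, j) \<in> D" "(r, j') \<in> D" "j < j'" for r j j'
      using T_row that T_col M_antimono[of j j'] D_pos[OF that(1)]
      by (cases "r \<le> p") (simp_all add: diff_le_mono2)
    show "T (r, j) < T (r', j)" if c: "(r, j) \<in> D" "(r', j) \<in> D" "r < r'" for r r' j
    proof -
      consider "r' \<le> p" | "r \<le> p" "p < r'" | "p < r" by linarith
      thus ?thesis
      proof cases
        case 1
        thus ?thesis using c T_row by simp
      next
        case 2
        thus ?thesis using T_row[OF c(1)] T_gt[OF c(2)] by simp
      next
        case 3
        hence "M j < r" using D_col[of r j] c D_pos by simp
        thus ?thesis using T_col[OF c(1)] T_col[OF c(2)] c(3) 3 by simp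
      qed
    qed
  qed
  have row_cells: "{x \<in> D. T x = k} = Pair k ` {\<mu> k + 1..\<mu> k + \<kappa> k}" if k: "1 \<le> k" "k \<le> p" for k
  proof (intro equalityI subsetI)
    fix x assume x: "x \<in> {x \<in> D. T x = k}"
    obtain r j where rj: "x = (r, j)" by (cases x)
    have "r \<le> p" using x T_gt[of r j] k unfolding rj by (cases "r \<le> p") auto
    hence "r = k" using x T_row[of r j] unfolding rj by simp
    thus "x \<in> Pair k ` {\<mu> k + 1..\<mu> k + \<kappa> k}"
      using x D_row[OF \<open>r \<le> p\<close>] unfolding rj by auto
  next
    fix x assume "x \<in> Pair k ` {\<mu> k + 1..\<mu> k + \<kappa> k}"
    thus "x \<in> {x \<in> D. T x = k}" using D_row[OF k(2)] T_row k by auto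
  qed
  have content: "card {x \<in> D. T x = k} = \<kappa> k" if k: "1 \<le> k" for k
  proof (cases "k \<le> p")
    case True
    thus ?thesis unfolding row_cells[OF k True] by (subst card_image) (auto simp: inj_on_def)
  next
    case False
    have col: "j \<le> \<kappa> k \<longleftrightarrow> k \<le> p + K j" if "1 \<le> j" for j
    proof -
      have "k \<le> conjugate \<kappa> j \<longleftrightarrow> k \<le> p + K j" unfolding K_def using False by arith
      thus ?thesis using conj\<kappa>[OF that k] by simp
    qed
    \<comment> \<open>An entry k > p sits in column j exactly \<open>M j\<close> rows below row k,
      for the columns that meet row k of \<kappa>.\<close>
    have "{x \<in> D. T x = k} = (\<lambda>j. (k + M j, j)) ` {1..\<kappa> k}"
    proof (intro equalityI subsetI)
      fix x assume x: "x \<in> {x \<in> D. T x = k}"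
      obtain r j where rj: "x = (r, j)" by (cases x)
      have D: "(r, j) \<in> D" and T: "T (r, j) = k" using x unfolding rj by auto
      have "p < r" using T_row[OF D] T False by (cases "r \<le> p") auto
      note b = D_col[OF this D_pos(2)[OF D]]
      have "r = k + M j" using T_col[OF D \<open>p < r\<close>] T b D by simp
      moreover have "j \<le> \<kappa> k" using b D calculation col D_pos(2)[OF D] by simp
      ultimately show "x \<in> (\<lambda>j. (k + M j, j)) ` {1..\<kappa> k}" using D_pos(2)[OF D] unfolding rj by auto
    next
      fix x assume "x \<in> (\<lambda>j. (k + M j, j)) ` {1..\<kappa> k}"
      then obtain j where j: "x = (k + M j, j)" "1 \<le> j" "j \<le> \<kappa> k" by auto
      have D: "(k + M j, j) \<in> D" using D_col[of "k + M j" j] col[of j] j False by simp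
      thus "x \<in> {x \<in> D. T x = k}" using T_col[OF D] False unfolding j(1) by simp
    qed
    thus ?thesis by (simp add: card_image inj_on_def)
  qed
  have fin: "finite D" unfolding D_def by (rule finite_skew_diagram[OF \<rho>])
  \<comment> \<open>For k \<le> p all entries k form row k, so either no k + 1 has been read or
    every k has, and \<kappa> decreases. For k > p each k + 1 has a k directly above it.\<close>
  have "lattice_word (reverse_row_word \<rho> \<mu> T)"
  proof (rule lattice_wordI[OF \<rho>])
    fix k s :: nat assume k: "1 \<le> k"
    show "entries_upto \<rho> \<mu> T (Suc k) (Suc s) \<le> entries_upto \<rho> \<mu> T k s"
      unfolding entries_upto_def D_def[symmetric]
    proof (cases "k \<le> p")
      case True
      show "card {x \<in> D. T x = Suc k \<and> fst x \<le> Suc s} \<le> card {x \<in> D. T x = k \<and> fst x \<le> s}"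
      proof (cases "s < k")
        case True
        have "\<not> (T x = Suc k \<and> fst x \<le> Suc s)" for x
          using T_le_row[of "fst x" "snd x"] True by auto
        hence "{x \<in> D. T x = Suc k \<and> fst x \<le> Suc s} = {}" by blast
        thus ?thesis by (simp only: card.empty le0)
      next
        case False
        have "card {x \<in> D. T x = Suc k \<and> fst x \<le> Suc s} \<le> card {x \<in> D. T x = Suc k}"
          using fin by (intro card_mono) auto
        also have "\<dots> \<le> card {x \<in> D. T x = k}"
          using content[of "Suc k"] content[of k] k is_partition_antimono[OF \<kappa> k, of "Suc k"] by simp
        also have "{x \<in> D. T x = k} = {x \<in> D. T x = k \<and> fst x \<le> s}"
          using row_cells[OF k True] False by auto
        finally show ?thesis .
      qed
    next
      case False
      show "card {x \<in> D. T x = Suc k \<and> fst x \<le> Suc s} \<le> card {x \<in> D. T x = k \<and> fst x \<le> s}"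
      proof (rule card_inj_on_le)
        let ?g = "\<lambda>(r, j). (r - 1, j) :: nat \<times> nat"
        show "inj_on ?g {x \<in> D. T x = Suc k \<and> fst x \<le> Suc s}"
        proof (rule inj_onI, clarsimp)
          fix r r' j assume "(r, j) \<in> D" "(r', j) \<in> D" "r - Suc 0 = r' - Suc 0"
          thus "r = r'" using D_pos(1)[of r j] D_pos(1)[of r' j] by simp
        qed
        show "?g ` {x \<in> D. T x = Suc k \<and> fst x \<le> Suc s} \<subseteq> {x \<in> D. T x = k \<and> fst x \<le> s}"
        proof clarsimp
          fix r j assume D: "(r, j) \<in> D" and T: "T (r, j) = Suc k" and "r \<le> Suc s"
          have p: "p < r" using T_row[OF D] T False by (cases "r \<le> p") auto
          have r: "r = Suc k + M j" using T_col[OF D p] T by simp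
          have D': "(r - 1, j) \<in> D"
            using D_col[OF p D_pos(2)[OF D]] D_col[of "r - 1" j] D D_pos(2)[OF D] r False by simp
          thus "(r - Suc 0, j) \<in> D \<and> T (r - Suc 0, j) = k \<and> r - Suc 0 \<le> s"
            using T_col[OF D'] r False \<open>r \<le> Suc s\<close> by simp
        qed
      qed (simp add: fin)
    qed
  qed
  hence "lr_filling \<rho> \<mu> T" using ss by (simp add: lr_filling_def)
  moreover have "has_content \<rho> \<mu> T \<kappa>"
    using content by (simp add: has_content_def D_def)
  moreover have "diagram \<mu> \<subseteq> diagram \<rho>"
  proof -
    have "j \<le> \<rho> r" if "1 \<le> r" "1 \<le> j" "j \<le> \<mu> r" for r j
    proof (cases "r \<le> p")
      case False
      have "r \<le> conjugate \<mu> j" using conj\<mu>[of j r] that by simp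
      hence "r \<le> h j" unfolding h_def M_def by arith
      thus ?thesis using \<rho>_iff False that by simp
    qed (use that in \<open>simp add: \<rho>_def\<close>)
    thus ?thesis by (auto simp: diagram_def)
  qed
  ultimately show ?thesis using \<rho> \<rho>_max keys_outer_prod[OF \<mu> \<kappa>] by blast
qed

text \<open>Every constituent contains \<mu> as a subdiagram, and its parts bound the content
  \<kappa>; so the maximum is a lower bound.\<close>

lemma base_partition_outer_prod:
  assumes \<mu>: "is_partition \<mu>" and \<kappa>: "is_partition \<kappa>"
  shows "base_partition (outer_prod \<mu> \<kappa>) = (\<lambda>i. max (\<mu> i) (\<kappa> i))"
proof
  fix i
  let ?keys = "Poly_Mapping.keys (outer_prod \<mu> \<kappa>)"
  have le: "max (\<mu> i) (\<kappa> i) \<le> \<rho> i" if "\<rho> \<in> ?keys" for \<rho>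
  proof (cases "i = 0")
    case True
    thus ?thesis using is_partition_zero[OF \<mu>] is_partition_zero[OF \<kappa>] by simp
  next
    case False
    obtain T where \<rho>: "is_partition \<rho>" and sub: "diagram \<mu> \<subseteq> diagram \<rho>"
      and T: "lr_filling \<rho> \<mu> T" "has_content \<rho> \<mu> T \<kappa>"
      using \<open>\<rho> \<in> ?keys\<close> unfolding keys_outer_prod[OF assms] by blast
    have "\<kappa> i \<le> \<rho> i"
      using lr_filling_content_le[OF \<rho> T(1), of i] T(2) False by (simp add: has_content_def)
    moreover have "\<mu> i \<le> \<rho> i"
      using subsetD[OF sub, of "(i, \<mu> i)"] False by (cases "\<mu> i = 0") (auto simp: diagram_def)
    ultimately show ?thesis by simp
  qed
  have "\<exists>\<rho>\<in>?keys. \<rho> i = max (\<mu> i) (\<kappa> i)"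
  proof (cases i)
    case 0
    \<comment> \<open>At index 0 every partition vanishes, but \<open>Min\<close> still needs a
      nonempty set.\<close>
    obtain \<rho> where "\<rho> \<in> ?keys" using outer_prod_key_with_part_max[OF assms] by blast
    moreover from this have "\<rho> 0 = 0" unfolding keys_outer_prod[OF assms] by (simp add: is_partition_zero)
    ultimately show ?thesis using 0 is_partition_zero[OF \<mu>] is_partition_zero[OF \<kappa>] by auto
  next
    case (Suc p)
    thus ?thesis using outer_prod_key_with_part_max[OF assms] by simp
  qed
  thus "base_partition (outer_prod \<mu> \<kappa>) i = max (\<mu> i) (\<kappa> i)"
    unfolding base_partition_def using le by (intro Min_eqI) (auto intro: rev_image_eqI)
qed

section \<open>The cover partition of a skew character\<close>

text \<open>To maximise part \<open>i\<close>, start from the filling whose columns read \<open>1, 2, 3, \<dots>\<close>. With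
  \<open>m = l + 1 - i\<close>, each of the first \<open>\<mu>\<^sub>m\<close> columns is too short to contain \<open>i\<close>. Column \<open>j\<close> among them
  is paired with column \<open>j + (\<lambda>\<^sub>1 - \<mu>\<^sub>m)\<close>, one of the last \<open>\<mu>\<^sub>m\<close> columns of the rectangle, and takes
  over the entries up to \<open>i\<close> that do not occur in its partner, placed so that the last row has entry \<open>i\<close>.
  For such an entry without its predecessor above it, the lattice property matches the last
  entry of the partner column.\<close>

lemma lr_filling_with_many_entries:
  assumes lam: "is_partition lam" and l: "plength lam = l" and n: "n \<le> l"
    and top: "\<forall>i\<in>{1..n}. lam i = lam 1"
    and \<mu>: "is_partition \<mu>" and \<mu>1: "\<mu> 1 \<le> lam l" and len\<mu>: "plength \<mu> \<le> n"
    and i: "1 \<le> i" "i \<le> l"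
  shows "\<exists>T. lr_filling lam \<mu> T \<and>
    min (lam i) (lam 1 - \<mu> (l + 1 - i)) \<le> card {x \<in> skew_diagram lam \<mu>. T x = i}"
proof -
  define m where "m = l + 1 - i"
  define d where "d = lam 1 - \<mu> m"
  \<comment> \<open>With a = r + 1 - m as the new entry, \<open>lam a < j + d\<close> says that
    column j + d of \<lambda> is too short to reach row a. In row l this a equals i.\<close>
  define P where "P r j \<longleftrightarrow> m \<le> r \<and> j \<le> \<mu> m \<and> lam (r + 1 - m) < j + d" for r j
  define D where "D = skew_diagram lam \<mu>"
  define T where "T = (\<lambda>(r, j). if (r, j) \<in> D then if P r j then r + 1 - m else r - conjugate \<mu> j else 0)"
  have m: "1 \<le> m" "m \<le> l" "l + 1 - m = i" using i by (auto simp: m_def)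
  have \<mu>_le: "\<mu> r \<le> \<mu> 1" if "1 \<le> r" for r using is_partition_antimono[OF \<mu> _ that] by simp
  have lam_ge: "lam l \<le> lam r" if "1 \<le> r" "r \<le> l" for r by (rule is_partition_antimono[OF lam that])
  have lam_le: "lam r \<le> lam 1" if "1 \<le> r" for r using is_partition_antimono[OF lam _ that] by simp
  have d: "\<mu> m + d = lam 1" using \<mu>_le[OF m(1)] \<mu>1 lam_ge[of 1] m by (simp add: d_def)
  note conj\<mu> = is_partition_le_conjugate_iff[OF \<mu>]
  have \<mu>_conj: "j \<le> \<mu> (conjugate \<mu> j)" if "1 \<le> j" "1 \<le> conjugate \<mu> j" for j
    using conj\<mu>[OF that] by simp
  have conj_le_n: "conjugate \<mu> j \<le> n" if "1 \<le> j" for j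
  proof (cases "conjugate \<mu> j = 0")
    case False
    hence "\<mu> (conjugate \<mu> j) \<noteq> 0" using \<mu>_conj[OF that] that by simp
    thus ?thesis using plength_pos_iff[OF \<mu>, of "conjugate \<mu> j"] False len\<mu> by simp
  qed simp
  have conj_m: "j \<le> \<mu> m \<longleftrightarrow> m \<le> conjugate \<mu> j" if "1 \<le> j" for j
    using conj\<mu>[OF that m(1)] by simp
  have conj_zero: "conjugate \<mu> j = 0" if "\<mu> 1 < j" for j
    using \<mu>_conj[of j] \<mu>_le[of "conjugate \<mu> j"] that by (cases "conjugate \<mu> j = 0") auto
  \<comment> \<open>The partner column lies within the rectangle and the first n rows are full, so
    no entry up to n is missing from it.\<close>
  have P_n: "n + m \<le> r" if "P r j" for r j
  proof (rule ccontr)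
    assume "\<not> n + m \<le> r"
    hence "r + 1 - m \<in> {1..n}" using that by (auto simp: P_def)
    hence "lam (r + 1 - m) = lam 1" using top by blast
    thus False using that d by (simp add: P_def)
  qed
  have P_mono: "P r' j" if "P r j" "r \<le> r'" for r r' j
    using that is_partition_antimono[OF lam, of "r + 1 - m" "r' + 1 - m"]
    by (auto simp: P_def Suc_diff_le diff_le_mono dest: le_less_trans)
  have D_iff: "(r, j) \<in> D \<longleftrightarrow> 1 \<le> r \<and> conjugate \<mu> j < r \<and> j \<le> lam r" if "1 \<le> j" for r j
    using conj\<mu>[OF that, of r] by (auto simp: D_def mem_skew_diagram_iff)
  have D_pos: "1 \<le> r" "1 \<le> j" if "(r, j) \<in> D" for r j
    using that by (auto simp: D_def mem_skew_diagram_iff)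
  have D_conj: "conjugate \<mu> j < r" "j \<le> lam r" if "(r, j) \<in> D" for r j
    using D_iff[OF D_pos(2)[OF that]] that by auto
  have D_l: "r \<le> l" if "(r, j) \<in> D" for r j
    using skew_diagram_row_le_plength[OF lam] that l unfolding D_def by fastforce
  have T_P: "T (r, j) = r + 1 - m" if "(r, j) \<in> D" "P r j" for r j
    using that by (simp add: T_def)
  have T_nP: "T (r, j) = r - conjugate \<mu> j" if "(r, j) \<in> D" "\<not> P r j" for r j
    using that by (simp add: T_def)
  have P_m: "m \<le> r" "m \<le> conjugate \<mu> j" if "(r, j) \<in> D" "P r j" for r j
    using conj_m[OF D_pos(2)[OF that(1)]] that(2) by (auto simp: P_def)
  \<comment> \<open>In the columns up to \<open>\<mu> m\<close>, \<mu> has height at least m, so the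
    replacement only raises entries, and it applies to a lower end of each column. To the right of
    these columns the height is below m, so the usual entry is already at least r + 1 - m.\<close>
  have ss: "semistandard lam \<mu> T"
  proof (rule semistandardI; fold D_def)
    show "T (r, j) = 0" if "(r, j) \<notin> D" for r j using that by (simp add: T_def)
    show "1 \<le> T (r, j)" if "(r, j) \<in> D" for r j
      using T_P[OF that] T_nP[OF that] D_conj[OF that] P_m[OF that] by (cases "P r j") auto
    show "T (r, j) \<le> T (r, j')" if D: "(r, j) \<in> D" "(r, j') \<in> D" and j: "j < j'" for r j j'
    proof -
      have anti: "conjugate \<mu> j' \<le> conjugate \<mu> j"
        using conjugate_antimono[OF \<mu> D_pos(2)[OF D(1)]] j by simp
      show ?thesis
      proof (cases "P r j")
        case True
        show ?thesis
        proof (cases "P r j'")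
          case False
          hence "\<not> j' \<le> \<mu> m" using True j by (auto simp: P_def)
          hence "conjugate \<mu> j' < m" using conj_m[OF D_pos(2)[OF D(2)]] by simp
          thus ?thesis using T_P[OF D(1) True] T_nP[OF D(2) False] by simp
        qed (simp add: T_P D True)
      next
        case False
        show ?thesis
        proof (cases "P r j'")
          case True
          have "m \<le> conjugate \<mu> j" using P_m[OF D(2) True] anti by simp
          thus ?thesis using T_nP[OF D(1) False] T_P[OF D(2) True] by simp
        next
          case nP: False
          show ?thesis using T_nP[OF D(1) False] T_nP[OF D(2) nP] anti by simp
        qed
      qed
    qed
    show "T (r, j) < T (r', j)" if D: "(r, j) \<in> D" "(r', j) \<in> D" and r: "r < r'" for r r' j
    proof (cases "P r j")
      case True
      thus ?thesis using T_P[OF D(1) True] T_P[OF D(2)] P_mono[OF True, of r'] P_m[OF D(1) True] r by simp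
    next
      case False
      show ?thesis
      proof (cases "P r' j")
        case True
        thus ?thesis using T_nP[OF D(1) False] T_P[OF D(2) True] P_m[OF D(2) True] D_conj[OF D(1)] r by simp
      next
        case nP: False
        thus ?thesis using T_nP[OF D(1) False] T_nP[OF D(2) nP] D_conj[OF D(1)] r by simp
      qed
    qed
  qed
  define above where "above k r j \<longleftrightarrow> (r - 1, j) \<in> D \<and> T (r - 1, j) = k" for k r j
  define g where "g k = (\<lambda>(r, j). if above k r j then (r - 1, j) else (k, j + d))" for k
  \<comment> \<open>The exceptional cell is the topmost replaced one of its column. Its partner
    column ends exactly in row k, which makes the matching injective.\<close>
  have partner: "r = k + m \<and> lam (Suc k) < j + d \<and> (k, j + d) \<in> D \<and> T (k, j + d) = k"
    if k: "1 \<le> k" and D: "(r, j) \<in> D" and T: "T (r, j) = Suc k" and na: "\<not> above k r j" for k r j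
  proof -
    have j: "1 \<le> j" by (rule D_pos(2)[OF D])
    have above_iff: "(r - 1, j) \<in> D \<longleftrightarrow> conjugate \<mu> j < r - 1"
      using D_iff[OF j, of "r - 1"] D_conj[OF D] is_partition_antimono[OF lam, of "r - 1" r] by auto
    have P: "P r j"
    proof (rule ccontr)
      assume nP: "\<not> P r j"
      have r: "r = Suc k + conjugate \<mu> j" using T T_nP[OF D nP] by simp
      hence D': "(r - 1, j) \<in> D" using above_iff k by simp
      have "\<not> P (r - 1) j" using P_mono[of "r - 1" j r] nP by auto
      hence "above k r j" using T_nP[OF D'] D' r by (simp add: above_def)
      with na show False by simp
    qed
    hence r: "r = k + m" using T T_P[OF D] P_m[OF D] by simp
    have nk: "n \<le> k" using P_n[OF P] r by simp
    have gt: "lam (Suc k) < j + d" using P r by (simp add: P_def)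
    \<comment> \<open>Either the cell above is in the diagram but not replaced, so k is not missing
      from the partner column; or it is not in the diagram, which forces k \<le> n and a full row
      k.\<close>
    have le: "j + d \<le> lam k"
    proof (cases "(r - 1, j) \<in> D")
      case True
      have "\<not> P (r - 1) j" using T_P[OF True] True na r m(1) by (auto simp: above_def)
      moreover have "m \<le> r - 1" "j \<le> \<mu> m" using r k P by (auto simp: P_def)
      ultimately show ?thesis using r m(1) by (simp add: P_def not_less)
    next
      case False
      hence "r - 1 \<le> conjugate \<mu> j" using above_iff by simp
      hence "r - 1 \<le> n" using conj_le_n[OF j] by simp
      hence "k \<in> {1..n}" using r m(1) k by simp
      hence "lam k = lam 1" using top by blast
      thus ?thesis using P d by (simp add: P_def)
    qed
    have kl: "Suc k \<le> l" using r m(1) D_l[OF D] by simp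
    \<comment> \<open>Here \<open>\<mu> 1 \<le> lam l\<close> puts the partner column to the right
      of \<mu>, so that it reads 1, 2, 3, ... from row 1.\<close>
    have big: "\<mu> 1 < j + d" using gt \<mu>1 lam_ge[OF _ kl] by simp
    have D': "(k, j + d) \<in> D" using D_iff[of "j + d" k] j k le conj_zero[OF big] by simp
    have "\<not> P k (j + d)" using big \<mu>_le[OF m(1)] by (simp add: P_def)
    hence "T (k, j + d) = k" using T_nP[OF D'] conj_zero[OF big] by simp
    with r gt D' show ?thesis by simp
  qed
  have "lattice_word (reverse_row_word lam \<mu> T)"
  proof (rule lattice_wordI_injection[OF lam]; fold D_def)
    fix k :: nat assume k: "1 \<le> k"
    show "inj_on (g k) {x \<in> D. T x = Suc k}"
    proof (rule inj_onI)
      fix x y assume x: "x \<in> {x \<in> D. T x = Suc k}" and y: "y \<in> {x \<in> D. T x = Suc k}" and eq: "g k x = g k y"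
      obtain r j r' j' where xy: "x = (r, j)" "y = (r', j')" by (cases x, cases y)
      have D: "(r, j) \<in> D" "(r', j') \<in> D" and T: "T (r, j) = Suc k" "T (r', j') = Suc k"
        using x y unfolding xy by auto
      \<comment> \<open>A collision would place a cell in row k + 1 of a partner column, which ends
        in row k.\<close>
      have mixed: False
        if "(r, j) \<in> D" "T (r', j') = Suc k" "(r', j') \<in> D" "\<not> above k r' j'" "(r - 1, j) = (k, j' + d)" for r j r' j'
      proof -
        have "r = Suc k" "j = j' + d" using that(5) D_pos(1)[OF that(1)] by auto
        thus False using partner[OF k that(3,2,4)] D_conj[OF that(1)] by simp
      qed
      have "r = r' \<and> j = j'"
      proof (cases "above k r j"; cases "above k r' j'")
        assume "above k r j" "above k r' j'"
        thus ?thesis using eq D_pos(1)[OF D(1)] D_pos(1)[OF D(2)] unfolding xy g_def by auto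
      next
        assume "above k r j" "\<not> above k r' j'"
        thus ?thesis using eq mixed[OF D(1) T(2) D(2)] unfolding xy g_def by simp
      next
        assume "\<not> above k r j" "above k r' j'"
        thus ?thesis using eq mixed[OF D(2) T(1) D(1)] unfolding xy g_def by simp
      next
        assume "\<not> above k r j" "\<not> above k r' j'"
        thus ?thesis using eq partner[OF k D(1) T(1)] partner[OF k D(2) T(2)] unfolding xy g_def by simp
      qed
      thus "x = y" unfolding xy by simp
    qed
    fix x assume x: "x \<in> D" "T x = Suc k"
    obtain r j where rj: "x = (r, j)" by (cases x)
    show "g k x \<in> D \<and> T (g k x) = k \<and> fst (g k x) < fst x"
    proof (cases "above k r j")
      case True
      thus ?thesis using D_pos(1)[of r j] x unfolding rj by (simp add: g_def above_def)
    next
      case False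
      thus ?thesis using partner[OF k x[unfolded rj] False] m(1) unfolding rj by (simp add: g_def)
    qed
  qed
  hence "lr_filling lam \<mu> T" using ss by (simp add: lr_filling_def)
  moreover have "min (lam i) (lam 1 - \<mu> (l + 1 - i)) \<le> card {x \<in> D. T x = i}"
  proof -
    \<comment> \<open>The last min(\<open>lam i\<close>, \<open>d\<close>) columns of row i. The
      lower end is chosen so that \<open>lam i < j + d\<close>: columns up to \<open>\<mu> m\<close>
      then receive i in row l, and the others have it in its usual place.\<close>
    let ?J = "{lam i - d + 1..lam i}"
    let ?\<phi> = "\<lambda>j. (if j \<le> \<mu> m then l else i + conjugate \<mu> j, j)"
    have "min (lam i) (lam 1 - \<mu> (l + 1 - i)) = card ?J" by (simp add: d_def m_def)
    also have "\<dots> \<le> card {x \<in> D. T x = i}"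
    proof (rule card_inj_on_le)
      show "inj_on ?\<phi> ?J" by (simp add: inj_on_def)
      show "?\<phi> ` ?J \<subseteq> {x \<in> D. T x = i}"
      proof (rule image_subsetI)
        fix j assume j: "j \<in> ?J"
        show "?\<phi> j \<in> {x \<in> D. T x = i}"
        proof (cases "j \<le> \<mu> m")
          case True
          have P: "P l j" using True j m by (auto simp: P_def)
          have "conjugate \<mu> j < l" using conj_le_n[of j] P_n[OF P] m(1) j by simp
          moreover have "j \<le> lam l" using True \<mu>_le[OF m(1)] \<mu>1 by simp
          ultimately have D: "(l, j) \<in> D" using D_iff[of j l] j m by simp
          thus ?thesis using True T_P[OF D P] m(3) by simp
        next
          case False
          have j1: "1 \<le> j" using j by simp
          let ?r = "i + conjugate \<mu> j"
          have c: "conjugate \<mu> j < m" using False conj_m[OF j1] by simp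
          have "j \<le> lam ?r"
          proof (cases "conjugate \<mu> j = 0")
            case False
            have "j \<le> \<mu> 1" using \<mu>_conj[OF j1] \<mu>_le[of "conjugate \<mu> j"] False by simp
            also have "\<dots> \<le> lam ?r" using \<mu>1 lam_ge[of ?r] c i unfolding m_def by linarith
            finally show ?thesis .
          qed (use j in simp)
          hence D: "(?r, j) \<in> D" using D_iff[OF j1, of ?r] i by simp
          have "\<not> P ?r j" using False by (simp add: P_def)
          thus ?thesis using False D T_nP[OF D] by simp
        qed
      qed
    qed (simp add: D_def finite_skew_diagram[OF lam])
    finally show ?thesis .
  qed
  ultimately show ?thesis unfolding D_def by blast
qed

lemma cover_partition_skew_char:
  assumes lam: "is_partition lam" and l: "plength lam = l" and n: "n \<le> l"
    and top: "\<forall>i\<in>{1..n}. lam i = lam 1"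
    and \<mu>: "is_partition \<mu>" and \<mu>1: "\<mu> 1 \<le> lam l" and len\<mu>: "plength \<mu> \<le> n"
  shows "cover_partition (skew_char lam \<mu>)
    = (\<lambda>i. if 1 \<le> i \<and> i \<le> l then min (lam i) (lam 1 - \<mu> (l + 1 - i)) else 0)"
proof
  fix i
  let ?keys = "Poly_Mapping.keys (skew_char lam \<mu>)"
  have sub: "diagram \<mu> \<subseteq> diagram lam"
  proof -
    have "j \<le> lam r" if "1 \<le> r" "1 \<le> j" "j \<le> \<mu> r" for r j
    proof -
      have "r \<le> n" using plength_pos_iff[OF \<mu> that(1)] that len\<mu> by simp
      hence "lam l \<le> lam r" using is_partition_antimono[OF lam that(1), of l] n by simp
      thus ?thesis using is_partition_antimono[OF \<mu> _ that(1)] that \<mu>1 by fastforce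
    qed
    thus ?thesis by (auto simp: diagram_def)
  qed
  note keys = keys_skew_char[OF lam \<mu> sub]
  have zero: "lam i = 0" if "\<not> (1 \<le> i \<and> i \<le> l)" for i
    using that plength_pos_iff[OF lam, of i] is_partition_zero[OF lam] l by (cases "i = 0") auto
  have le: "\<nu> i \<le> (if 1 \<le> i \<and> i \<le> l then min (lam i) (lam 1 - \<mu> (l + 1 - i)) else 0)"
    if "\<nu> \<in> ?keys" for \<nu>
  proof -
    obtain T where \<nu>: "is_partition \<nu>" and T: "lr_filling lam \<mu> T" "has_content lam \<mu> T \<nu>"
      using \<open>\<nu> \<in> ?keys\<close> unfolding keys by blast
    show ?thesis
    proof (cases "i = 0")
      case False
      have \<nu>i: "\<nu> i = card {x \<in> skew_diagram lam \<mu>. T x = i}" using T(2) False by (simp add: has_content_def)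
      have "\<nu> i \<le> lam i" unfolding \<nu>i using False by (intro lr_filling_content_le[OF lam T(1)]) simp
      moreover have "\<nu> i \<le> lam 1 - \<mu> (l + 1 - i)" if "i \<le> l"
        using lr_filling_content_le_diff[OF lam \<mu> T(1), of i] that False l \<nu>i by simp
      ultimately show ?thesis using zero[of i] by auto
    qed (simp add: is_partition_zero[OF \<nu>])
  qed
  have ex: "\<exists>\<nu>\<in>?keys. min (lam i) (lam 1 - \<mu> (l + 1 - i)) \<le> \<nu> i" if i: "1 \<le> i" "i \<le> l" for i
  proof -
    obtain T where "lr_filling lam \<mu> T"
      and "min (lam i) (lam 1 - \<mu> (l + 1 - i)) \<le> card {x \<in> skew_diagram lam \<mu>. T x = i}"
      using lr_filling_with_many_entries[OF assms i] by blast
    thus ?thesis using lr_filling_content_in_keys[OF lam \<mu> sub, of T] i by (intro bexI) auto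
  qed
  have "\<exists>\<nu>\<in>?keys. (if 1 \<le> i \<and> i \<le> l then min (lam i) (lam 1 - \<mu> (l + 1 - i)) else 0) \<le> \<nu> i"
  proof (cases "l = 0")
    case True
    \<comment> \<open>For the empty diagram the zero filling supplies the constituent that
      \<open>Max\<close> needs.\<close>
    have "skew_diagram lam \<mu> = {}" using zero True by (auto simp: mem_skew_diagram_iff)
    hence "lr_filling lam \<mu> (\<lambda>_. 0)"
      using True l by (simp add: lr_filling_def semistandard_def lattice_word_def reverse_row_word_def)
    from lr_filling_content_in_keys[OF lam \<mu> sub this] show ?thesis using True by (intro bexI) auto
  next
    case False
    \<comment> \<open>Outside 1..l the value is 0 and any constituent serves; index 1 provides
      one.\<close>
    thus ?thesis using ex[of i] ex[of 1] by (auto split: if_splits)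
  qed
  then obtain \<nu> where \<nu>: "\<nu> \<in> ?keys"
    and ge: "(if 1 \<le> i \<and> i \<le> l then min (lam i) (lam 1 - \<mu> (l + 1 - i)) else 0) \<le> \<nu> i"
    by blast
  from ge le[OF \<nu>] have eq: "(if 1 \<le> i \<and> i \<le> l then min (lam i) (lam 1 - \<mu> (l + 1 - i)) else 0) = \<nu> i"
    by (rule antisym)
  have "(if 1 \<le> i \<and> i \<le> l then min (lam i) (lam 1 - \<mu> (l + 1 - i)) else 0) \<in> (\<lambda>\<alpha>. \<alpha> i) ` ?keys"
    by (rule image_eqI[OF _ \<nu>]) (simp only: eq)
  thus "cover_partition (skew_char lam \<mu>) i
      = (if 1 \<le> i \<and> i \<le> l then min (lam i) (lam 1 - \<mu> (l + 1 - i)) else 0)"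
    unfolding cover_partition_def using le by (intro Max_eqI) auto
qed

section \<open>Complements in the rectangle\<close>

lemma is_partition_inv_partition:
  assumes "is_partition lam"
  shows "is_partition (inv_partition n lam)"
  unfolding is_partition_def
proof (intro conjI allI impI)
  show "inv_partition n lam (Suc i) \<le> inv_partition n lam i" if "1 \<le> i" for i
    using that is_partition_antimono[OF assms, of "plength lam + 1 - Suc i" "plength lam + 1 - i"]
    by (auto simp: inv_partition_def intro!: diff_le_mono2)
  have "{i. inv_partition n lam i \<noteq> 0} \<subseteq> {..plength lam - n}"
    by (auto simp: inv_partition_def split: if_splits)
  thus "finite {i. inv_partition n lam i \<noteq> 0}" by (rule finite_subset) simp
qed (simp add: inv_partition_def)

text \<open>The cells to the right of \<open>\<beta> i\<close> in row i become the leading cells of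
  row l + 1 - i; where \<open>\<beta> i\<close> exceeds b, both rows are empty.\<close>

lemma rotate180_skew_diagram_rect:
  "rotate180 l b (skew_diagram (rect l b) \<beta>)
    = diagram (\<lambda>i. if 1 \<le> i \<and> i \<le> l then b - \<beta> (l + 1 - i) else 0)" (is "?L = ?R")
proof (intro equalityI subsetI)
  fix x assume "x \<in> ?L"
  then obtain i j where x: "x = (l + 1 - i, b + 1 - j)" and ij: "(i, j) \<in> skew_diagram (rect l b) \<beta>"
    by (auto simp: rotate180_def)
  have "1 \<le> i" "i \<le> l" "\<beta> i < j" "j \<le> b" using ij by (auto simp: mem_skew_diagram_iff rect_def split: if_splits)
  thus "x \<in> ?R" unfolding x by (auto simp: diagram_def)
next
  fix x assume x: "x \<in> ?R"
  obtain r c where rc: "x = (r, c)" by (cases x)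
  have "1 \<le> r" "r \<le> l" "1 \<le> c" "c \<le> b - \<beta> (l + 1 - r)"
    using x unfolding rc by (auto simp: diagram_def split: if_splits)
  hence "(l + 1 - r, b + 1 - c) \<in> skew_diagram (rect l b) \<beta>"
      "x = (\<lambda>(i, j). (l + 1 - i, b + 1 - j)) (l + 1 - r, b + 1 - c)"
    unfolding rc by (auto simp: mem_skew_diagram_iff rect_def)
  thus "x \<in> ?L" unfolding rotate180_def by (rule rev_image_eqI)
qed

theorem theorem4p4:
  fixes lam mu beta :: "nat \<Rightarrow> nat" and l n :: nat
  assumes "is_partition lam" and "plength lam = l"
    and "n \<le> l" and "\<forall>i\<in>{1..n}. lam i = lam 1"
    and "is_partition mu" and "mu 1 \<le> lam l" and "plength mu \<le> n"
    and "beta = base_partition (outer_prod mu (inv_partition n lam))"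
  shows "diagram beta \<subseteq> diagram (rect l (lam 1)) \<and>
    diagram (cover_partition (skew_char lam mu))
      = rotate180 l (lam 1) (skew_diagram (rect l (lam 1)) beta) \<and>
    cover_partition (skew_char lam mu)
      = (\<lambda>i. if 1 \<le> i \<and> i \<le> l then lam 1 - beta (l + 1 - i) else 0)"
proof -
  have beta: "beta i = max (mu i) (inv_partition n lam i)" for i
    using base_partition_outer_prod[OF assms(5) is_partition_inv_partition[OF assms(1)]] assms(8) by simp
  have "diagram beta \<subseteq> diagram (rect l (lam 1))"
  proof -
    have "mu r \<le> (if r \<le> l then lam 1 else 0)" if "1 \<le> r" for r
    proof (cases "mu r = 0")
      case False
      hence "r \<le> n" using plength_pos_iff[OF assms(5) that] assms(7) by simp
      hence "mu r \<le> lam 1"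
        using is_partition_antimono[OF assms(5) _ that] assms(6) that assms(3)
          is_partition_antimono[OF assms(1), of 1 l] by fastforce
      thus ?thesis using \<open>r \<le> n\<close> assms(3) by simp
    qed simp
    moreover have "inv_partition n lam r \<le> (if r \<le> l then lam 1 else 0)" for r
      using assms(2) by (simp add: inv_partition_def)
    ultimately have "beta r \<le> (if r \<le> l then lam 1 else 0)" if "1 \<le> r" for r
      using that by (simp add: beta)
    thus ?thesis by (fastforce simp: diagram_def rect_def dest: order_trans)
  qed
  moreover have "cover_partition (skew_char lam mu)
      = (\<lambda>i. if 1 \<le> i \<and> i \<le> l then lam 1 - beta (l + 1 - i) else 0)"
  proof -
    have "min (lam i) (lam 1 - mu (l + 1 - i)) = lam 1 - beta (l + 1 - i)" if i: "1 \<le> i" "i \<le> l" for i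
    proof -
      have "lam i \<le> lam 1" using is_partition_antimono[OF assms(1) _ i(1)] by simp
      moreover have "inv_partition n lam (l + 1 - i) = lam 1 - lam i"
      proof (cases "i \<le> n")
        \<comment> \<open>The index l + 1 - i exceeds l - n, so \<open>inv_partition\<close> takes
          its default 0, which is \<open>lam 1 - lam i\<close> in a full row.\<close>
        case True
        hence "lam i = lam 1" using assms(4) i by (meson atLeastAtMost_iff)
        thus ?thesis using i True assms(2,3) by (auto simp: inv_partition_def)
      next
        case False
        thus ?thesis using i assms(2) by (auto simp: inv_partition_def)
      qed
      ultimately show ?thesis by (simp add: beta)
    qed
    thus ?thesis unfolding cover_partition_skew_char[OF assms(1-7)] by auto
  qed
  ultimately show ?thesis by (simp only: rotate180_skew_diagram_rect)
qed

end
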